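(* Let $d\ge 2$, let $\Lambda\subseteq\mathbb Z^d$ be finite and connected, and let $V\subseteq\Lambda^{\mathrm{in}}$ be a good set. Let $h_\Lambda$ be the height-one field of the Abelian sandpile model on $\Lambda$ (under its stationary measure, with expectation $\mathbb E$), let $\langle\cdot\rangle^{\mathbf p}_\Lambda$ be the normalized fermionic Gaussian free field state pinned at the ghost vertex $g$, and let $X_v,Y_v$ be the Grassmann observables $$X_v=\frac1{2d}\sum_{i=1}^{2d}\nabla_{e_i}\psi(v)\nabla_{e_i}\bar\psi(v),\qquad Y_v=\prod_{i=1}^{2d}\bigl(1-\nabla_{e_i}\psi(v)\nabla_{e_i}\bar\psi(v)\bigr).$$ Then $$\mathbb E\Bigl(\prod_{v\in V}h_\Lambda(v)\Bigr)=\Bigl\langle\prod_{v\in V}X_vY_v\Bigr\rangle^{\mathbf p}_\Lambda .$$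
   Context: Lattice. $e_1,\dots,e_d$ are the standard basis vectors of $\mathbb R^d$ and $e_{d+i}=-e_i$. $u\sim v$ means nearest neighbours in $\mathbb Z^d$. $\partial^{\mathrm{in}}\Lambda$ is the set of $u\in\Lambda$ having a neighbour outside $\Lambda$, and $\Lambda^{\mathrm{in}}=\Lambda\setminus\partial^{\mathrm{in}}\Lambda$. $\Delta_\Lambda(u,v)$ ($u,v\in\Lambda$) equals $-2d$ if $u=v$, $1$ if $u\sim v$, $0$ otherwise. $\Lambda^g=\Lambda\cup\{g\}$ is the wired graph in which all vertices outside $\Lambda$ adjacent to $\Lambda$ are identified with the ghost vertex $g$ (keeping multiple edges). $\Delta^g$ is the symmetric matrix on $\Lambda^g$ with $\Delta^g(u,v)=\Delta_\Lambda(u,v)$ for $u,v\in\Lambda$, $\Delta^g(u,g)=\Delta^g(g,u)=$ number of neighbours of $u$ outside $\Lambda$, $\Delta^g(g,g)=-|\partial^{\mathrm{in}}\Lambda|$. Good set. $A\subseteq\Lambda$ is good if no two points of $A$ are nearest neighbours and for each $v\in\Lambda\setminus A$ there is a nearest-neighbour path in $\Lambda^g$ from $v$ to $g$ disjoint from $A$. Sandpile. The Abelian sandpile model on $\Lambda$ is the Markov chain on stable configurations $\{1,\dots,2d\}^\Lambda$: at each step add one grain at a uniformly chosen site; any site with height $>2d$ topples (loses $2d$ grains, each neighbour in $\Lambda$ gains one, grains sent to $g$ are lost) until stable. Its unique stationary measure is uniform on recurrent configurations. $h_\Lambda(v)=\mathbf 1_{\{\rho(v)=1\}}$, $\rho$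 distributed according to the stationary measure. Grassmann algebra. $\Omega^{2\Lambda^g}$ is the real Grassmann algebra with generators $\psi_v,\bar\psi_v$, $v\in\Lambda^g$ (all generators pairwise anticommute and square to zero; $\bar\psi$ is only notation). $\partial_\xi$ is the left derivative: on a monomial $\xi_{i_1}\cdots\xi_{i_p}$ in which $\xi=\xi_{i_\alpha}$ it gives $(-1)^{\alpha-1}$ times the monomial with $\xi_{i_\alpha}$ removed; it gives $0$ if $\xi$ does not occur. Functions such as $\exp$ of an algebra element are defined by their (finite) power series. $\nabla_{e_i}\psi(v)=\psi_{v+e_i}-\psi_v$, $\nabla_{e_i}\bar\psi(v)=\bar\psi_{v+e_i}-\bar\psi_v$. The unnormalized pinned state is $$[F]^{\mathbf p}_\Lambda=\Bigl(\prod_{v\in\Lambda^g}\partial_{\bar\psi_v}\partial_{\psi_v}\Bigr)\psi_g\bar\psi_g\exp\Bigl(\sum_{u,v\in\Lambda^g}\psi_u(-\Delta^g(u,v))\bar\psi_v+\psi_g\bar\psi_g\Bigr)F,\quad F\in\Omega^{2\Lambda^g},$$ and the normalized state is $\langle F\rangle^{\mathbf p}_\Lambda=[F]^{\mathbf p}_\Lambda/[1]^{\mathbf p}_\Lambda$, with $[1]^{\mathbf p}_\Lambda=\det(-\Delta_\Lambda)$. *)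

theory Defs
  imports "HOL-Probability.Probability"
begin

section \<open>The real Grassmann algebra\<close>

text \<open>
  The Grassmann algebra over a countable type of generators. An element is represented by its
  coefficients in the basis of monomials; the monomial attached to a finite set of generators is
  the product of its elements in increasing order, for the (arbitrary but fixed) linear order
  pulled back along \<^const>\<open>to_nat\<close>. The characteristic identities \<open>ggen_anticommute\<close>, \<open>ggen_square\<close> and
  \<open>left_deriv_ggen_mult\<close> below do not mention this order.
\<close>

typedef 'g grassmann =
  "{f :: 'g set \<Rightarrow> real. finite {S. f S \<noteq> 0} \<and> (\<forall>S. infinite S \<longrightarrow> f S = 0)}"
  morphisms gcoeff Abs_grassmann
  by (rule exI[of _ "\<lambda>_. 0"]) simp

setup_lifting type_definition_grassmann

lemma gcoeff_infinite: "infinite S \<Longrightarrow> gcoeff F S = 0"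
  by transfer simp

lemma grassmann_eqI:
  assumes "\<And>S. finite S \<Longrightarrow> gcoeff F S = gcoeff G S"
  shows "F = G"
proof -
  have "gcoeff F = gcoeff G"
    using assms gcoeff_infinite by (metis ext)
  then show ?thesis by (simp add: gcoeff_inject)
qed

text \<open>The number of transpositions needed to sort an increasing word with letters \<open>S\<close> followed
  by an increasing word with letters \<open>T\<close>.\<close>

definition inversions :: "('g::countable) set \<Rightarrow> 'g set \<Rightarrow> nat" where
  "inversions S T = card {(s, t). s \<in> S \<and> t \<in> T \<and> to_nat t < to_nat s}"

lemma finite_inversions:
  "finite S \<Longrightarrow> finite T \<Longrightarrow> finite {(s, t). s \<in> S \<and> t \<in> T \<and> to_nat t < to_nat s}"
  by (rule finite_subset[of _ "S \<times> T"]) auto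

lemma inversions_Un_left:
  assumes "finite S" "finite T" "finite U" "S \<inter> T = {}"
  shows "inversions (S \<union> T) U = inversions S U + inversions T U"
proof -
  have "{(s, t). s \<in> S \<union> T \<and> t \<in> U \<and> to_nat t < to_nat s} =
      {(s, t). s \<in> S \<and> t \<in> U \<and> to_nat t < to_nat s} \<union> {(s, t). s \<in> T \<and> t \<in> U \<and> to_nat t < to_nat s}"
    by auto
  then show ?thesis
    using assms by (auto simp: inversions_def intro!: card_Un_disjoint finite_inversions)
qed

lemma inversions_Un_right:
  assumes "finite S" "finite T" "finite U" "T \<inter> U = {}"
  shows "inversions S (T \<union> U) = inversions S T + inversions S U"
proof -
  have "{(s, t). s \<in> S \<and> t \<in> T \<union> U \<and> to_nat t < to_nat s} =
      {(s, t). s \<in> S \<and> t \<in> T \<and> to_nat t < to_nat s} \<union> {(s, t). s \<in> S \<and> t \<in> U \<and> to_nat t < to_nat s}"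
    by auto
  then show ?thesis
    using assms by (auto simp: inversions_def intro!: card_Un_disjoint finite_inversions)
qed

instantiation grassmann :: (type) real_vector
begin

lift_definition zero_grassmann :: "'a grassmann" is "\<lambda>_. 0" by simp

lift_definition plus_grassmann :: "'a grassmann \<Rightarrow> 'a grassmann \<Rightarrow> 'a grassmann"
  is "\<lambda>f g S. f S + g S"
proof -
  fix f g :: "'a set \<Rightarrow> real"
  assume "finite {S. f S \<noteq> 0} \<and> (\<forall>S. infinite S \<longrightarrow> f S = 0)"
    and "finite {S. g S \<noteq> 0} \<and> (\<forall>S. infinite S \<longrightarrow> g S = 0)"
  moreover have "{S. f S + g S \<noteq> 0} \<subseteq> {S. f S \<noteq> 0} \<union> {S. g S \<noteq> 0}" by auto
  ultimately show "finite {S. f S + g S \<noteq> 0} \<and> (\<forall>S. infinite S \<longrightarrow> f S + g S = 0)"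
    by (auto intro: finite_subset)
qed

lift_definition uminus_grassmann :: "'a grassmann \<Rightarrow> 'a grassmann"
  is "\<lambda>f S. - f S" by simp

lift_definition scaleR_grassmann :: "real \<Rightarrow> 'a grassmann \<Rightarrow> 'a grassmann"
  is "\<lambda>c f S. c * f S"
  by (auto elim: rev_finite_subset)

definition minus_grassmann :: "'a grassmann \<Rightarrow> 'a grassmann \<Rightarrow> 'a grassmann" where
  "minus_grassmann F G = F + - G"

instance
  by standard (simp_all add: minus_grassmann_def, (transfer, auto simp: algebra_simps)+)

end

lemma gcoeff_simps [simp]:
  "gcoeff 0 S = 0"
  "gcoeff (F + G) S = gcoeff F S + gcoeff G S"
  "gcoeff (- F) S = - gcoeff F S"
  "gcoeff (F - G) S = gcoeff F S - gcoeff G S"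
  "gcoeff (c *\<^sub>R F) S = c * gcoeff F S"
  unfolding minus_grassmann_def by (transfer, simp)+

lift_definition grassmann_mult ::
  "('g::countable) grassmann \<Rightarrow> 'g grassmann \<Rightarrow> 'g grassmann"
  is "\<lambda>f g S. \<Sum>T\<in>Pow S. (-1) ^ inversions T (S - T) * f T * g (S - T)"
proof -
  fix f g :: "'g set \<Rightarrow> real"
  assume f: "finite {S. f S \<noteq> 0} \<and> (\<forall>S. infinite S \<longrightarrow> f S = 0)"
    and g: "finite {S. g S \<noteq> 0} \<and> (\<forall>S. infinite S \<longrightarrow> g S = 0)"
  let ?h = "\<lambda>S. \<Sum>T\<in>Pow S. (-1) ^ inversions T (S - T) * f T * g (S - T)"
  have "{S. ?h S \<noteq> 0} \<subseteq> (\<lambda>(T, U). T \<union> U) ` ({S. f S \<noteq> 0} \<times> {S. g S \<noteq> 0})"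
  proof
    fix S assume "S \<in> {S. ?h S \<noteq> 0}"
    then have "?h S \<noteq> 0" by simp
    then obtain T where "T \<in> Pow S" "(-1) ^ inversions T (S - T) * f T * g (S - T) \<noteq> 0"
      by (meson sum.neutral)
    then have "S = (\<lambda>(T, U). T \<union> U) (T, S - T)" "f T \<noteq> 0" "g (S - T) \<noteq> 0"
      by auto
    then show "S \<in> (\<lambda>(T, U). T \<union> U) ` ({S. f S \<noteq> 0} \<times> {S. g S \<noteq> 0})"
      by blast
  qed
  then have "finite {S. ?h S \<noteq> 0}"
    by (rule finite_subset) (use f g in auto)
  then show "finite {S. ?h S \<noteq> 0} \<and> (\<forall>S. infinite S \<longrightarrow> ?h S = 0)"
    by simp
qed

lift_definition gmonom :: "'g set \<Rightarrow> 'g grassmann" is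
  "\<lambda>S T. if finite S \<and> T = S then 1 else 0"
  by auto

lemma gcoeff_gmonom: "gcoeff (gmonom S) T = (if finite S \<and> T = S then 1 else 0)"
  by transfer simp

lemma gcoeff_grassmann_mult:
  "gcoeff (grassmann_mult F G) S =
    (\<Sum>T\<in>Pow S. (-1) ^ inversions T (S - T) * gcoeff F T * gcoeff G (S - T))"
  by transfer simp

lemma grassmann_mult_assoc:
  "grassmann_mult (grassmann_mult F G) H = grassmann_mult F (grassmann_mult G H)"
proof (rule grassmann_eqI)
  fix S :: "'a set" assume S: "finite S"
  let ?s = "\<lambda>T U. (-1) ^ inversions T U :: real"
  let ?t = "\<lambda>R Q W. ?s R Q * ?s R W * ?s Q W * gcoeff F R * gcoeff G Q * gcoeff H W"
  have fin: "finite T" if "T \<subseteq> S" for T using that S finite_subset by blast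
  have "gcoeff (grassmann_mult (grassmann_mult F G) H) S =
      (\<Sum>T\<in>Pow S. \<Sum>R\<in>Pow T. ?s T (S - T) * ?s R (T - R) * gcoeff F R * gcoeff G (T - R) * gcoeff H (S - T))"
    by (simp add: gcoeff_grassmann_mult sum_distrib_left sum_distrib_right mult_ac)
  also have "\<dots> = (\<Sum>T\<in>Pow S. \<Sum>R\<in>Pow T. ?t R (T - R) (S - T))"
  proof (intro sum.cong refl)
    fix T R assume TR: "T \<in> Pow S" "R \<in> Pow T"
    then have "inversions T (S - T) = inversions R (S - T) + inversions (T - R) (S - T)"
      using inversions_Un_left[of R "T - R" "S - T"] fin
      by (metis Diff_disjoint Diff_subset PowD Un_Diff_cancel2 Un_absorb2 Un_commute order_trans)
    then show "?s T (S - T) * ?s R (T - R) * gcoeff F R * gcoeff G (T - R) * gcoeff H (S - T)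
        = ?t R (T - R) (S - T)"
      by (simp add: power_add mult_ac)
  qed
  also have "\<dots> = (\<Sum>(T, R)\<in>(SIGMA T:Pow S. Pow T). ?t R (T - R) (S - T))"
    using fin S by (intro sum.Sigma) auto
  also have "\<dots> = (\<Sum>(R, Q)\<in>(SIGMA R:Pow S. Pow (S - R)). ?t R Q (S - R - Q))"
  proof (rule sum.reindex_bij_witness[where i = "\<lambda>(R, Q). (R \<union> Q, R)" and j = "\<lambda>(T, R). (R, T - R)"])
    fix p assume "p \<in> (SIGMA T:Pow S. Pow T)"
    then obtain T R where p: "p = (T, R)" "T \<subseteq> S" "R \<subseteq> T" by auto
    then have "S - R - (T - R) = S - T" by auto
    with p show "(case case p of (T, R) \<Rightarrow> (R, T - R) of (R, Q) \<Rightarrow> ?t R Q (S - R - Q)) =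
        (case p of (T, R) \<Rightarrow> ?t R (T - R) (S - T))"
      by simp
  qed auto
  also have "\<dots> = (\<Sum>R\<in>Pow S. \<Sum>Q\<in>Pow (S - R). ?t R Q (S - R - Q))"
    using fin S by (intro sum.Sigma[symmetric]) auto
  also have "\<dots> = (\<Sum>R\<in>Pow S. \<Sum>Q\<in>Pow (S - R). ?s R (S - R) * ?s Q (S - R - Q) * gcoeff F R * gcoeff G Q * gcoeff H (S - R - Q))"
  proof (intro sum.cong refl)
    fix R Q assume RQ: "R \<in> Pow S" "Q \<in> Pow (S - R)"
    then have "Q \<union> (S - R - Q) = S - R" by auto
    moreover have "finite R" "finite Q" "finite (S - R - Q)"
      using RQ by (auto intro!: fin)
    ultimately have "inversions R (S - R) = inversions R Q + inversions R (S - R - Q)"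
      using inversions_Un_right[of R Q "S - R - Q"] by simp
    then show "?t R Q (S - R - Q) =
        ?s R (S - R) * ?s Q (S - R - Q) * gcoeff F R * gcoeff G Q * gcoeff H (S - R - Q)"
      by (simp add: power_add mult_ac)
  qed
  also have "\<dots> = gcoeff (grassmann_mult F (grassmann_mult G H)) S"
    by (simp add: gcoeff_grassmann_mult sum_distrib_left mult_ac)
  finally show "gcoeff (grassmann_mult (grassmann_mult F G) H) S =
      gcoeff (grassmann_mult F (grassmann_mult G H)) S" .
qed

lemma inversions_empty: "inversions {} T = 0" "inversions S {} = 0"
  by (simp_all add: inversions_def)

lemma grassmann_mult_one:
  "grassmann_mult (gmonom {}) F = F" "grassmann_mult F (gmonom {}) = F"
proof -
  show "grassmann_mult (gmonom {}) F = F"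
  proof (rule grassmann_eqI)
    fix S :: "'a set" assume "finite S"
    have "gcoeff (grassmann_mult (gmonom {}) F) S =
        (\<Sum>T\<in>Pow S. if T = {} then gcoeff F S else 0)"
      unfolding gcoeff_grassmann_mult by (rule sum.cong) (auto simp: gcoeff_gmonom inversions_def)
    then show "gcoeff (grassmann_mult (gmonom {}) F) S = gcoeff F S"
      using \<open>finite S\<close> by simp
  qed
  show "grassmann_mult F (gmonom {}) = F"
  proof (rule grassmann_eqI)
    fix S :: "'a set" assume "finite S"
    have "gcoeff (grassmann_mult F (gmonom {})) S =
        (\<Sum>T\<in>Pow S. if T = S then gcoeff F S else 0)"
      unfolding gcoeff_grassmann_mult
    proof (rule sum.cong)
      fix T assume "T \<in> Pow S"
      then have "S - T = {} \<longleftrightarrow> T = S" by auto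
      then show "(-1) ^ inversions T (S - T) * gcoeff F T * gcoeff (gmonom {}) (S - T) =
          (if T = S then gcoeff F S else 0)"
        by (cases "T = S") (simp_all add: gcoeff_gmonom inversions_empty)
    qed simp
    then show "gcoeff (grassmann_mult F (gmonom {})) S = gcoeff F S"
      using \<open>finite S\<close> by simp
  qed
qed

instantiation grassmann :: (countable) real_algebra_1
begin

definition one_grassmann :: "'a grassmann" where
  "one_grassmann = gmonom {}"

definition times_grassmann :: "'a grassmann \<Rightarrow> 'a grassmann \<Rightarrow> 'a grassmann" where
  "times_grassmann = grassmann_mult"

instance
proof
  fix a b c :: "'a grassmann" and r :: real
  show "a * b * c = a * (b * c)"
    by (simp add: times_grassmann_def grassmann_mult_assoc)
  show "1 * a = a" "a * 1 = a"
    by (simp_all add: times_grassmann_def one_grassmann_def grassmann_mult_one)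
  show "(a + b) * c = a * c + b * c" "a * (b + c) = a * b + a * c"
    by (rule grassmann_eqI, simp add: times_grassmann_def gcoeff_grassmann_mult algebra_simps sum.distrib)+
  show "(r *\<^sub>R a) * b = r *\<^sub>R (a * b)" "a * (r *\<^sub>R b) = r *\<^sub>R (a * b)"
    by (rule grassmann_eqI, simp add: times_grassmann_def gcoeff_grassmann_mult sum_distrib_left mult_ac)+
  have "gcoeff (0 :: 'a grassmann) {} \<noteq> gcoeff (1 :: 'a grassmann) {}"
    by (simp add: one_grassmann_def gcoeff_gmonom)
  then show "(0 :: 'a grassmann) \<noteq> 1" by metis
qed

end

definition ggen :: "'g \<Rightarrow> 'g grassmann" where
  "ggen x = gmonom {x}"

text \<open>The left derivative. Moving \<open>x\<close> to the front of the increasing monomial of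
  \<open>insert x S\<close> costs one sign for each element of \<open>S\<close> below \<open>x\<close>.\<close>

lift_definition left_deriv :: "('g::countable) \<Rightarrow> 'g grassmann \<Rightarrow> 'g grassmann" is
  "\<lambda>x f S. if x \<in> S then 0 else (-1) ^ card {s \<in> S. to_nat s < to_nat x} * f (insert x S)"
proof -
  fix x :: 'g and f :: "'g set \<Rightarrow> real"
  let ?h = "\<lambda>S. if x \<in> S then 0 else (-1) ^ card {s \<in> S. to_nat s < to_nat x} * f (insert x S)"
  assume f: "finite {S. f S \<noteq> 0} \<and> (\<forall>S. infinite S \<longrightarrow> f S = 0)"
  have "{S. ?h S \<noteq> 0} \<subseteq> (\<lambda>S. S - {x}) ` {S. f S \<noteq> 0}"
  proof
    fix S assume "S \<in> {S. ?h S \<noteq> 0}"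
    then have "S = insert x S - {x}" "f (insert x S) \<noteq> 0" by (auto split: if_splits)
    then show "S \<in> (\<lambda>S. S - {x}) ` {S. f S \<noteq> 0}" by blast
  qed
  then have "finite {S. ?h S \<noteq> 0}"
    by (rule finite_subset) (use f in simp)
  then show "finite {S. ?h S \<noteq> 0} \<and> (\<forall>S. infinite S \<longrightarrow> ?h S = 0)"
    using f by simp
qed

lemma gcoeff_left_deriv:
  "gcoeff (left_deriv x F) S =
    (if x \<in> S then 0 else (-1) ^ card {s \<in> S. to_nat s < to_nat x} * gcoeff F (insert x S))"
  by transfer simp

lemma left_deriv_linear:
  "left_deriv x (F + G) = left_deriv x F + left_deriv x G"
  "left_deriv x (- F) = - left_deriv x F"
  "left_deriv x (F - G) = left_deriv x F - left_deriv x G"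
  "left_deriv x (c *\<^sub>R F) = c *\<^sub>R left_deriv x F"
  "left_deriv x 0 = 0"
  by (rule grassmann_eqI, simp add: gcoeff_left_deriv algebra_simps)+

lemma left_deriv_one: "left_deriv x 1 = 0"
  by (rule grassmann_eqI) (simp add: gcoeff_left_deriv one_grassmann_def gcoeff_gmonom)

lemma gcoeff_ggen_mult:
  assumes "finite S"
  shows "gcoeff (ggen x * F) S =
    (if x \<in> S then (-1) ^ card {s \<in> S. to_nat s < to_nat x} * gcoeff F (S - {x}) else 0)"
proof -
  have inv: "inversions {x} (S - {x}) = card {s \<in> S. to_nat s < to_nat x}"
  proof -
    have "{(s, t). s \<in> {x} \<and> t \<in> S - {x} \<and> to_nat t < to_nat s} =
        Pair x ` {s \<in> S. to_nat s < to_nat x}" by auto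
    then have "inversions {x} (S - {x}) = card (Pair x ` {s \<in> S. to_nat s < to_nat x})"
      unfolding inversions_def by (rule arg_cong)
    then show ?thesis by (simp add: card_image inj_on_def)
  qed
  have "gcoeff (ggen x * F) S =
      (\<Sum>T\<in>Pow S. if T = {x} then (-1) ^ inversions {x} (S - {x}) * gcoeff F (S - {x}) else 0)"
    unfolding times_grassmann_def gcoeff_grassmann_mult
    by (rule sum.cong) (auto simp: ggen_def gcoeff_gmonom)
  then show ?thesis using assms by (simp add: inv)
qed

lemma card_below_insert:
  fixes x y :: "'g::countable"
  assumes "finite S" "y \<notin> S"
  shows "card {s \<in> insert y S. to_nat s < to_nat x} =
    card {s \<in> S. to_nat s < to_nat x} + (if to_nat y < to_nat x then 1 else 0)"
proof -
  have "{s \<in> insert y S. to_nat s < to_nat x} =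
      (if to_nat y < to_nat x then insert y {s \<in> S. to_nat s < to_nat x}
       else {s \<in> S. to_nat s < to_nat x})" by auto
  then show ?thesis using assms by simp
qed

lemma card_below_remove:
  fixes x y :: "'g::countable"
  assumes "finite S" "y \<in> S"
  shows "card {s \<in> S. to_nat s < to_nat x} =
    card {s \<in> S - {y}. to_nat s < to_nat x} + (if to_nat y < to_nat x then 1 else 0)"
  using card_below_insert[of "S - {y}" y x] assms by (simp add: insert_absorb)

lemma to_nat_neq_cases:
  fixes x y :: "'g::countable"
  assumes "x \<noteq> y"
  shows "to_nat x < to_nat y \<and> \<not> to_nat y < to_nat x \<or> to_nat y < to_nat x \<and> \<not> to_nat x < to_nat y"
  using assms by (metis injD inj_to_nat less_asym linorder_neqE_nat)

lemma ggen_mult_left_anticommute: "ggen x * (ggen y * F) = - (ggen y * (ggen x * F))"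
proof (rule grassmann_eqI)
  fix S :: "'a set" assume S: "finite S"
  show "gcoeff (ggen x * (ggen y * F)) S = gcoeff (- (ggen y * (ggen x * F))) S"
  proof (cases "x \<in> S \<and> y \<in> S \<and> x \<noteq> y")
    case True
    then have "S - {x} - {y} = S - {y} - {x}" by auto
    then show ?thesis
      using S True to_nat_neq_cases[of x y]
        card_below_remove[of S y x] card_below_remove[of S x y]
      by (auto simp: gcoeff_ggen_mult)
  next
    case False
    then show ?thesis using S by (auto simp: gcoeff_ggen_mult)
  qed
qed

lemma ggen_anticommute: "ggen x * ggen y = - (ggen y * ggen x)"
  using ggen_mult_left_anticommute[of x y 1] by simp

lemma ggen_square: "ggen x * ggen x = 0"
proof (rule grassmann_eqI)
  fix S :: "'a set" assume S: "finite S"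
  then show "gcoeff (ggen x * ggen x) S = gcoeff 0 S"
    by (auto simp: gcoeff_ggen_mult) (auto simp: ggen_def gcoeff_gmonom)
qed

text \<open>Together with linearity and \<open>left_deriv_one\<close>, this is the rule for monomials: the derivative
  by the letter in position \<open>\<alpha>\<close> removes it and produces the sign \<open>(-1)\<close> to the power \<open>\<alpha> - 1\<close>.\<close>

lemma left_deriv_ggen_mult:
  "left_deriv x (ggen y * F) = (if x = y then F else 0) - ggen y * left_deriv x F"
proof (rule grassmann_eqI)
  fix S :: "'a set" assume S: "finite S"
  show "gcoeff (left_deriv x (ggen y * F)) S =
      gcoeff ((if x = y then F else 0) - ggen y * left_deriv x F) S"
  proof (cases "x = y")
    case True
    then show ?thesis using S card_below_insert[of S x x] card_below_remove[of S x x]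
      by (cases "x \<in> S")
        (simp_all add: gcoeff_ggen_mult gcoeff_left_deriv insert_absorb flip: power_add mult_2 mult.assoc)
  next
    case False
    show ?thesis
    proof (cases "x \<notin> S \<and> y \<in> S")
      case True
      then have "insert x (S - {y}) = insert x S - {y}" using False by auto
      then show ?thesis
        using S True False to_nat_neq_cases[of x y]
          card_below_insert[of S x y] card_below_remove[of S y x]
        by (auto simp: gcoeff_ggen_mult gcoeff_left_deriv)
    next
      case f2: False
      then show ?thesis using S False by (auto simp: gcoeff_ggen_mult gcoeff_left_deriv)
    qed
  qed
qed

lemma left_deriv_anticommute: "left_deriv x (left_deriv y F) = - left_deriv y (left_deriv x F)"
proof (rule grassmann_eqI)
  fix S :: "'a set" assume S: "finite S"
  show "gcoeff (left_deriv x (left_deriv y F)) S = gcoeff (- left_deriv y (left_deriv x F)) S"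
  proof (cases "x \<notin> S \<and> y \<notin> S \<and> x \<noteq> y")
    case True
    then show ?thesis
      using S to_nat_neq_cases[of x y] card_below_insert[of S x y] card_below_insert[of S y x]
      by (auto simp: gcoeff_left_deriv insert_commute)
  next
    case False
    then show ?thesis by (auto simp: gcoeff_left_deriv)
  qed
qed

text \<open>The power series of \<open>exp\<close>, which is a finite sum for elements without constant term; these
  are the only ones to which it is applied.\<close>

definition gexp :: "('g::countable) grassmann \<Rightarrow> 'g grassmann" where
  "gexp F = (\<Sum>k | F ^ k \<noteq> 0. (1 / fact k) *\<^sub>R F ^ k)"

text \<open>Product of a finite family of pairwise commuting elements; the order of the factors is
  left unspecified.\<close>

definition gprod :: "('a \<Rightarrow> ('g::countable) grassmann) \<Rightarrow> 'a set \<Rightarrow> 'g grassmann" where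
  "gprod f A = Finite_Set.fold (\<lambda>a P. f a * P) 1 A"

lemma gprod_empty: "gprod f {} = 1"
  by (simp add: gprod_def)

lemma gprod_insert:
  assumes "finite A" "a \<notin> A" "\<And>b c. b \<in> insert a A \<Longrightarrow> c \<in> insert a A \<Longrightarrow> f b * f c = f c * f b"
  shows "gprod f (insert a A) = f a * gprod f A"
proof -
  interpret comp_fun_commute_on "insert a A" "\<lambda>a P. f a * P"
    by standard (auto simp: fun_eq_iff assms(3) simp flip: mult.assoc)
  show ?thesis
    using assms by (simp add: gprod_def)
qed

lemma gprod_commute:
  assumes "finite A" "\<And>b c. b \<in> A \<Longrightarrow> c \<in> A \<Longrightarrow> f b * f c = f c * f b"
    and "\<And>b. b \<in> A \<Longrightarrow> z * f b = f b * z"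
  shows "z * gprod f A = gprod f A * z"
  using assms
proof (induction A rule: finite_induct)
  case empty
  show ?case by (simp add: gprod_empty)
next
  case (insert a A)
  have eq: "gprod f (insert a A) = f a * gprod f A"
    using insert by (intro gprod_insert) auto
  have "z * gprod f A = gprod f A * z"
    using insert by auto
  then show ?case
    by (metis eq insert.prems(2) insertI1 mult.assoc)
qed


section \<open>The lattice and the wired graph\<close>

text \<open>The dimension is the cardinality of the finite type \<open>'d\<close>.\<close>

definition unit_steps :: "(int ^ 'd) set" where
  "unit_steps = {e. \<exists>i. e = axis i 1 \<or> e = - axis i 1}"

lemma card_unit_steps:
  "finite (unit_steps :: (int ^ 'd) set)" "card (unit_steps :: (int ^ 'd) set) = 2 * CARD('d)"
proof -
  have axis: "axis i (1::int) = axis j 1 \<longleftrightarrow> i = j" "axis i (1::int) \<noteq> - axis j 1" for i j :: 'd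
    by (auto simp: vec_eq_iff axis_def split: if_splits)
  have eq: "(unit_steps :: (int ^ 'd) set) =
      range (\<lambda>i. axis i 1) \<union> range (\<lambda>i. - axis i 1)"
    by (auto simp: unit_steps_def)
  show "finite (unit_steps :: (int ^ 'd) set)" by (simp add: eq)
  have "card (unit_steps :: (int ^ 'd) set) =
      card (range (\<lambda>i::'d. axis i (1::int))) + card (range (\<lambda>i::'d. - axis i (1::int)))"
    unfolding eq by (rule card_Un_disjoint) (auto simp: axis)
  also have "\<dots> = 2 * CARD('d)"
    by (simp add: card_image inj_on_def axis)
  finally show "card (unit_steps :: (int ^ 'd) set) = 2 * CARD('d)" .
qed

definition neighbours :: "int ^ 'd \<Rightarrow> int ^ 'd \<Rightarrow> bool" (infix \<open>\<sim>\<close> 50) where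
  "u \<sim> v \<longleftrightarrow> v - u \<in> unit_steps"

definition lattice_connected :: "(int ^ 'd) set \<Rightarrow> bool" where
  "lattice_connected \<Lambda> \<longleftrightarrow>
    (\<forall>u\<in>\<Lambda>. \<forall>v\<in>\<Lambda>. (\<lambda>x y. x \<in> \<Lambda> \<and> y \<in> \<Lambda> \<and> x \<sim> y)\<^sup>*\<^sup>* u v)"

definition inner_boundary :: "(int ^ 'd) set \<Rightarrow> (int ^ 'd) set" where
  "inner_boundary \<Lambda> = {u \<in> \<Lambda>. \<exists>w. w \<notin> \<Lambda> \<and> u \<sim> w}"

definition lattice_interior :: "(int ^ 'd) set \<Rightarrow> (int ^ 'd) set" where
  "lattice_interior \<Lambda> = \<Lambda> - inner_boundary \<Lambda>"

definition laplacian :: "int ^ 'd \<Rightarrow> int ^ 'd \<Rightarrow> real" where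
  "laplacian u v = (if u = v then - 2 * real CARD('d) else if u \<sim> v then 1 else 0)"

text \<open>In the wired graph, \<^const>\<open>None\<close> is the ghost vertex \<open>g\<close>.\<close>

definition wired :: "(int ^ 'd) set \<Rightarrow> (int ^ 'd) option set" where
  "wired \<Lambda> = insert None (Some ` \<Lambda>)"

fun wired_adj :: "(int ^ 'd) set \<Rightarrow> (int ^ 'd) option \<Rightarrow> (int ^ 'd) option \<Rightarrow> bool" where
  "wired_adj \<Lambda> (Some u) (Some v) \<longleftrightarrow> u \<in> \<Lambda> \<and> v \<in> \<Lambda> \<and> u \<sim> v"
| "wired_adj \<Lambda> (Some u) None \<longleftrightarrow> u \<in> inner_boundary \<Lambda>"
| "wired_adj \<Lambda> None (Some v) \<longleftrightarrow> v \<in> inner_boundary \<Lambda>"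
| "wired_adj \<Lambda> None None \<longleftrightarrow> False"

fun wired_laplacian :: "(int ^ 'd) set \<Rightarrow> (int ^ 'd) option \<Rightarrow> (int ^ 'd) option \<Rightarrow> real" where
  "wired_laplacian \<Lambda> (Some u) (Some v) = laplacian u v"
| "wired_laplacian \<Lambda> (Some u) None = real (card {w. w \<notin> \<Lambda> \<and> u \<sim> w})"
| "wired_laplacian \<Lambda> None (Some v) = real (card {w. w \<notin> \<Lambda> \<and> v \<sim> w})"
| "wired_laplacian \<Lambda> None None = - real (card (inner_boundary \<Lambda>))"

definition good_set :: "(int ^ 'd) set \<Rightarrow> (int ^ 'd) set \<Rightarrow> bool" where
  "good_set \<Lambda> A \<longleftrightarrow> A \<subseteq> \<Lambda> \<and> (\<forall>u\<in>A. \<forall>v\<in>A. \<not> u \<sim> v) \<and>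
    (\<forall>v\<in>\<Lambda> - A.
      (\<lambda>x y. wired_adj \<Lambda> x y \<and> x \<notin> Some ` A \<and> y \<notin> Some ` A)\<^sup>*\<^sup>* (Some v) None)"


section \<open>The Abelian sandpile model\<close>

text \<open>Height configurations on \<open>\<Lambda>\<close> are functions that are \<^const>\<open>undefined\<close> outside \<open>\<Lambda>\<close>.\<close>

definition stable_configs :: "(int ^ 'd) set \<Rightarrow> (int ^ 'd \<Rightarrow> nat) set" where
  "stable_configs \<Lambda> = \<Lambda> \<rightarrow>\<^sub>E {1..2 * CARD('d)}"

definition topple :: "(int ^ 'd) set \<Rightarrow> int ^ 'd \<Rightarrow> (int ^ 'd \<Rightarrow> nat) \<Rightarrow> (int ^ 'd \<Rightarrow> nat)" where
  "topple \<Lambda> v \<eta> = (\<lambda>u\<in>\<Lambda>.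
    if u = v then \<eta> u - 2 * CARD('d) else if v \<sim> u then \<eta> u + 1 else \<eta> u)"

definition legal_toppling ::
  "(int ^ 'd) set \<Rightarrow> (int ^ 'd \<Rightarrow> nat) \<Rightarrow> (int ^ 'd \<Rightarrow> nat) \<Rightarrow> bool" where
  "legal_toppling \<Lambda> \<eta> \<eta>' \<longleftrightarrow> (\<exists>v\<in>\<Lambda>. \<eta> v > 2 * CARD('d) \<and> \<eta>' = topple \<Lambda> v \<eta>)"

text \<open>By the Abelian property the result does not depend on the order of the topplings.\<close>

definition stabilize :: "(int ^ 'd) set \<Rightarrow> (int ^ 'd \<Rightarrow> nat) \<Rightarrow> (int ^ 'd \<Rightarrow> nat)" where
  "stabilize \<Lambda> \<eta> =
    (THE \<sigma>. (legal_toppling \<Lambda>)\<^sup>*\<^sup>* \<eta> \<sigma> \<and> (\<forall>v\<in>\<Lambda>. \<sigma> v \<le> 2 * CARD('d)))"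

definition sandpile_kernel :: "(int ^ 'd) set \<Rightarrow> (int ^ 'd \<Rightarrow> nat) \<Rightarrow> (int ^ 'd \<Rightarrow> nat) pmf" where
  "sandpile_kernel \<Lambda> \<eta> = map_pmf (\<lambda>v. stabilize \<Lambda> (\<eta>(v := \<eta> v + 1))) (pmf_of_set \<Lambda>)"

definition sandpile_stationary :: "(int ^ 'd) set \<Rightarrow> (int ^ 'd \<Rightarrow> nat) pmf \<Rightarrow> bool" where
  "sandpile_stationary \<Lambda> \<pi> \<longleftrightarrow>
    set_pmf \<pi> \<subseteq> stable_configs \<Lambda> \<and> bind_pmf \<pi> (sandpile_kernel \<Lambda>) = \<pi>"

definition sandpile_measure :: "(int ^ 'd) set \<Rightarrow> (int ^ 'd \<Rightarrow> nat) pmf" where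
  "sandpile_measure \<Lambda> = (THE \<pi>. sandpile_stationary \<Lambda> \<pi>)"

definition height_one :: "int ^ 'd \<Rightarrow> (int ^ 'd \<Rightarrow> nat) \<Rightarrow> real" where
  "height_one v \<rho> = (if \<rho> v = 1 then 1 else 0)"


section \<open>The pinned fermionic Gaussian free field\<close>

text \<open>All fields live in the Grassmann algebra over the generators attached to the whole lattice and
  the ghost, of which the algebra over the wired graph of \<open>\<Lambda>\<close> is a subalgebra.\<close>

type_synonym 'd fermions = "((int ^ 'd) option + (int ^ 'd) option) grassmann"

abbreviation psi :: "(int ^ 'd::finite) option \<Rightarrow> 'd fermions" (\<open>\<psi>\<close>) where
  "\<psi> v \<equiv> ggen (Inl v)"

abbreviation psibar :: "(int ^ 'd::finite) option \<Rightarrow> 'd fermions" (\<open>\<psi>bar\<close>) where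
  "\<psi>bar v \<equiv> ggen (Inr v)"

definition grad_psi :: "int ^ 'd \<Rightarrow> int ^ 'd \<Rightarrow> ('d::finite) fermions" where
  "grad_psi e v = \<psi> (Some (v + e)) - \<psi> (Some v)"

definition grad_psibar :: "int ^ 'd \<Rightarrow> int ^ 'd \<Rightarrow> ('d::finite) fermions" where
  "grad_psibar e v = \<psi>bar (Some (v + e)) - \<psi>bar (Some v)"

definition fermion_X :: "int ^ 'd \<Rightarrow> ('d::finite) fermions" where
  "fermion_X v = (1 / (2 * real CARD('d))) *\<^sub>R (\<Sum>e\<in>unit_steps. grad_psi e v * grad_psibar e v)"

definition fermion_Y :: "int ^ 'd \<Rightarrow> ('d::finite) fermions" where
  "fermion_Y v = gprod (\<lambda>e. 1 - grad_psi e v * grad_psibar e v) unit_steps"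

lemma grad_anticommute:
  "grad_psi e v * grad_psi f w = - (grad_psi f w * grad_psi e v)"
  "grad_psi e v * grad_psibar f w = - (grad_psibar f w * grad_psi e v)"
  "grad_psibar e v * grad_psibar f w = - (grad_psibar f w * grad_psibar e v)"
proof -
  have *: "(ggen a - ggen b) * (ggen c - ggen d) = - ((ggen c - ggen d) * (ggen a - ggen b))"
    for a b c d :: "'g::countable"
    by (simp add: left_diff_distrib right_diff_distrib ggen_anticommute[of a] ggen_anticommute[of b])
  show "grad_psi e v * grad_psi f w = - (grad_psi f w * grad_psi e v)"
    "grad_psi e v * grad_psibar f w = - (grad_psibar f w * grad_psi e v)"
    "grad_psibar e v * grad_psibar f w = - (grad_psibar f w * grad_psibar e v)"
    unfolding grad_psi_def grad_psibar_def by (rule *)+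
qed

lemma grad_pair_commute:
  "(grad_psi e v * grad_psibar e v) * (grad_psi f w * grad_psibar f w) =
    (grad_psi f w * grad_psibar f w) * (grad_psi e v * grad_psibar e v)"
proof -
  have *: "(a * b) * (c * d) = (c * d) * (a * b)"
    if "a * c = - (c * a)" "b * c = - (c * b)" "a * d = - (d * a)" "b * d = - (d * b)"
    for a b c d :: "'a fermions"
  proof -
    have "(a * b) * (c * d) = a * (b * c) * d" by (simp add: mult.assoc)
    also have "\<dots> = - ((a * c) * (b * d))" using that(2) by (simp add: mult.assoc)
    also have "\<dots> = - ((c * a) * (d * b))" using that(1,4) by simp
    also have "\<dots> = - (c * (a * d) * b)" by (simp add: mult.assoc)
    also have "\<dots> = (c * d) * (a * b)" using that(3) by (simp add: mult.assoc)
    finally show ?thesis .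
  qed
  have "grad_psibar e v * grad_psi f w = - (grad_psi f w * grad_psibar e v)"
    using grad_anticommute(2)[of f w e v] by simp
  then show ?thesis
    by (intro * grad_anticommute) 
qed

text \<open>The factors multiplied by \<^const>\<open>gprod\<close> in \<^const>\<open>fermion_Y\<close>, and the observables
  \<open>fermion_X v * fermion_Y v\<close> for different \<open>v\<close>, commute pairwise.\<close>

lemma fermion_Y_factors_commute:
  "(1 - grad_psi e v * grad_psibar e v) * (1 - grad_psi f w * grad_psibar f w) =
    (1 - grad_psi f w * grad_psibar f w) * (1 - grad_psi e v * grad_psibar e v)"
  by (simp add: left_diff_distrib right_diff_distrib grad_pair_commute[of e v])

lemma fermion_XY_commute:
  fixes v w :: "int ^ 'd"
  shows "(fermion_X v * fermion_Y v) * (fermion_X w * fermion_Y w) =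
    (fermion_X w * fermion_Y w) * (fermion_X v * fermion_Y v)"
proof -
  have commute_mult: "z * (a * b) = (a * b) * z" if "z * a = a * z" "z * b = b * z"
    for z a b :: "'d fermions"
  proof -
    have "z * (a * b) = a * (z * b)" using that(1) by (simp flip: mult.assoc)
    also have "\<dots> = (a * b) * z" using that(2) by (simp add: mult.assoc)
    finally show ?thesis .
  qed
  note pp = fermion_Y_factors_commute
  have Xp: "fermion_X v * (1 - grad_psi f w * grad_psibar f w) =
      (1 - grad_psi f w * grad_psibar f w) * fermion_X v" for v f w :: "int ^ 'd"
  proof -
    have "fermion_X v * (grad_psi f w * grad_psibar f w) =
        (grad_psi f w * grad_psibar f w) * fermion_X v"
      by (simp add: fermion_X_def sum_distrib_left sum_distrib_right grad_pair_commute[of f w])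
    then show ?thesis by (simp add: left_diff_distrib right_diff_distrib)
  qed
  have XX: "fermion_X v * fermion_X w = fermion_X w * fermion_X v" for v w :: "int ^ 'd"
  proof -
    have "(\<Sum>e\<in>unit_steps. grad_psi e v * grad_psibar e v) * (\<Sum>f\<in>unit_steps. grad_psi f w * grad_psibar f w)
        = (\<Sum>f\<in>unit_steps. grad_psi f w * grad_psibar f w) * (\<Sum>e\<in>unit_steps. grad_psi e v * grad_psibar e v)"
      unfolding sum_product by (subst sum.swap) (simp add: grad_pair_commute[of _ v])
    then show ?thesis by (simp add: fermion_X_def)
  qed
  have XY: "fermion_X v * fermion_Y w = fermion_Y w * fermion_X v" for v w :: "int ^ 'd"
    unfolding fermion_Y_def by (rule gprod_commute; rule card_unit_steps(1) pp Xp)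
  have Yp: "fermion_Y v * (1 - grad_psi f w * grad_psibar f w) =
      (1 - grad_psi f w * grad_psibar f w) * fermion_Y v" for v f w :: "int ^ 'd"
    unfolding fermion_Y_def by (rule gprod_commute[symmetric]; rule card_unit_steps(1) pp)
  have YY: "fermion_Y v * fermion_Y w = fermion_Y w * fermion_Y v" for v w :: "int ^ 'd"
    unfolding fermion_Y_def[of w] by (rule gprod_commute; rule card_unit_steps(1) pp Yp)
  show "(fermion_X v * fermion_Y v) * (fermion_X w * fermion_Y w) =
      (fermion_X w * fermion_Y w) * (fermion_X v * fermion_Y v)"
    by (rule commute_mult; rule commute_mult[symmetric]; rule XX YY XY XY[symmetric])
qed

definition gff_action :: "(int ^ 'd) set \<Rightarrow> ('d::finite) fermions" where
  "gff_action \<Lambda> =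
    (\<Sum>u\<in>wired \<Lambda>. \<Sum>v\<in>wired \<Lambda>. (- wired_laplacian \<Lambda> u v) *\<^sub>R (\<psi> u * \<psi>bar v))"

text \<open>The operator obtained by composing, over all \<open>v\<close> in \<open>A\<close>, the pairs of derivatives by
  \<open>\<psi> v\<close> (applied first) and \<open>\<psi>bar v\<close>. Different pairs commute.\<close>

definition berezin :: "(int ^ 'd) option set \<Rightarrow> 'd fermions \<Rightarrow> ('d::finite) fermions" where
  "berezin A F = Finite_Set.fold (\<lambda>v G. left_deriv (Inr v) (left_deriv (Inl v) G)) F A"

lemma berezin_insert:
  assumes "finite A" "v \<notin> A"
  shows "berezin (insert v A) F = left_deriv (Inr v) (left_deriv (Inl v) (berezin A F))"
proof -
  interpret comp_fun_commute "\<lambda>v G. left_deriv (Inr v) (left_deriv (Inl v) G) :: 'a fermions"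
  proof
    fix u v :: "(int ^ 'a) option"
    have "left_deriv (Inr v) (left_deriv (Inl v) (left_deriv (Inr u) (left_deriv (Inl u) G))) =
        left_deriv (Inr u) (left_deriv (Inl u) (left_deriv (Inr v) (left_deriv (Inl v) G)))" for G :: "'a fermions"
      by (simp add: left_deriv_linear left_deriv_anticommute[of "Inl v" "Inr u"]
          left_deriv_anticommute[of "Inl v" "Inl u"] left_deriv_anticommute[of "Inr v" "Inr u"]
          left_deriv_anticommute[of "Inr v" "Inl u"])
    then show "(\<lambda>G. left_deriv (Inr v) (left_deriv (Inl v) G)) \<circ> (\<lambda>G. left_deriv (Inr u) (left_deriv (Inl u) G)) =
        (\<lambda>G. left_deriv (Inr u) (left_deriv (Inl u) G)) \<circ> (\<lambda>G. left_deriv (Inr v) (left_deriv (Inl v) G :: 'a fermions))"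
      by (simp add: fun_eq_iff)
  qed
  show ?thesis using assms by (simp add: berezin_def)
qed

text \<open>When \<open>F\<close> only involves generators of the wired graph of \<open>\<Lambda>\<close>, all of these are
  differentiated away and a multiple of \<open>1\<close> remains; \<open>gcoeff _ {}\<close> reads off the scalar.\<close>

definition pinned_unnormalized :: "(int ^ 'd) set \<Rightarrow> ('d::finite) fermions \<Rightarrow> real" where
  "pinned_unnormalized \<Lambda> F =
    gcoeff (berezin (wired \<Lambda>)
      (\<psi> None * \<psi>bar None * gexp (gff_action \<Lambda> + \<psi> None * \<psi>bar None) * F)) {}"

definition pinned_state :: "(int ^ 'd) set \<Rightarrow> ('d::finite) fermions \<Rightarrow> real" where
  "pinned_state \<Lambda> F = pinned_unnormalized \<Lambda> F / pinned_unnormalized \<Lambda> 1"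

end

theory Submission
  imports Defs "HOL-Library.Confluence"
begin

text \<open>
  Both sides are quotients of counts of burnable configurations. On a finite vertex set \<open>S\<close> with
  capacities \<open>D v\<close>, at least the number of neighbours of \<open>v\<close> in \<open>S\<close>, call a configuration with
  heights in \<open>{1..D v}\<close> burnable if no nonempty \<open>F \<subseteq> S\<close> is forbidden, that is, has all its heights
  bounded by the number of neighbours inside \<open>F\<close>.

  The number of burnable configurations is a fermionic partition function. Raising \<open>D v\<close> by one adds
  the configurations whose height at \<open>v\<close> is the new maximum; there \<open>v\<close> burns at once, so these
  correspond to the burnable configurations of \<open>S - {v}\<close>. The Berezin integral of \<open>exp\<close> of the action with diagonal \<open>D\<close> and off-diagonal part minus the adjacency
  obeys the same recursion, because the new mass contributes a factor \<open>1 + \<psi>\<^sub>v \<psi>bar\<^sub>v\<close> and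
  \<open>\<psi>\<^sub>v \<psi>bar\<^sub>v\<close> deletes the vertex. When \<open>D\<close> equals the degree in a nonempty \<open>S\<close>, there is no sink:
  \<open>S\<close> itself is forbidden, and the action is invariant under a common shift of all \<open>\<psi>\<^sub>v\<close>, so that
  both quantities vanish (\<open>card_burnable_upd\<close>, \<open>partition_function_add_mass\<close>,
  \<open>partition_function_no_sink\<close>, \<open>card_burnable_eq_partition_function\<close>).

  On the probabilistic side, adding a grain and stabilizing permutes the burnable configurations with
  capacities \<open>2d\<close>, and every stationary measure lives on them and is invariant under these
  permutations; since the full configuration can be reached from anywhere, it is uniform
  (\<open>stationary_is_uniform\<close>). If the sites of \<open>V\<close> have height one, each of them burns only after all
  its neighbours, which therefore have to burn while it is unburnt: such configurations correspond to
  the burnable configurations of \<open>\<Lambda> - V\<close> in which each capacity is lowered by the number of neighbours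
  in \<open>V\<close> (\<open>card_burnable_height_one\<close>).

  On the fermionic side, the factor \<open>\<psi>\<^sub>g \<psi>bar\<^sub>g\<close> deletes the ghost from the action. The action
  is a sum over edges of \<open>\<nabla>\<psi> \<nabla>\<psi>bar\<close>, each with square zero, so \<open>Y\<^sub>v\<close> is the exponential of minus
  the edges at \<open>v\<close> and removes them, leaving the action on \<open>\<Lambda> - V\<close> with the lowered diagonal. The
  fields at \<open>v \<in> V\<close> then occur in \<open>X\<^sub>v\<close> alone, where only \<open>\<psi>\<^sub>v \<psi>bar\<^sub>v\<close> survives, with coefficient
  one (\<open>gexp_bonds_XY\<close>, \<open>berezin_fermion_X\<close>).
\<close>

section \<open>Bosonic elements and exponentials in a Grassmann algebra\<close>

lemma finite_gcoeff_support: "finite {S. gcoeff F S \<noteq> 0}"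
  by transfer simp

lemma gcoeff_sum: "gcoeff (\<Sum>i\<in>I. f i) S = (\<Sum>i\<in>I. gcoeff (f i) S)"
  by (induction I rule: infinite_finite_induct) auto

lemma gmonom_insert:
  assumes "finite S" "x \<notin> S"
  shows "gmonom (insert x S) = (-1) ^ card {s \<in> S. to_nat s < to_nat x} *\<^sub>R (ggen x * gmonom S)"
proof (rule grassmann_eqI)
  fix T :: "'a set" assume T: "finite T"
  have 1: "{s \<in> insert x S. to_nat s < to_nat x} = {s \<in> S. to_nat s < to_nat x}" by auto
  have 2: "T - {x} = S \<longleftrightarrow> T = insert x S" if "x \<in> T" using that assms by auto
  show "gcoeff (gmonom (insert x S)) T =
      gcoeff ((-1) ^ card {s \<in> S. to_nat s < to_nat x} *\<^sub>R (ggen x * gmonom S)) T"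
    using assms T 1 2 by (auto simp: gcoeff_gmonom gcoeff_ggen_mult simp flip: power_add mult_2)
qed

text \<open>
  Every element is a linear combination of words in the generators, so a property preserved by linear
  combinations may be proved letter by letter. This gives commutation relations with arbitrary
  elements without mentioning the order of the monomials.
\<close>

lemma grassmann_induct [case_names one add scale gen]:
  assumes one: "P 1"
    and add: "\<And>F G. P F \<Longrightarrow> P G \<Longrightarrow> P (F + G)"
    and scale: "\<And>c F. P F \<Longrightarrow> P (c *\<^sub>R F)"
    and gen: "\<And>x F. P F \<Longrightarrow> P (ggen x * F)"
  shows "P (F :: 'g::countable grassmann)"
proof -
  have mon: "P (gmonom S)" if "finite S" for S
    using that
  proof (induction S)
    case empty
    then show ?case using one by (simp add: one_grassmann_def)
  next
    case (insert x S)
    then show ?case by (simp add: gmonom_insert scale gen)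
  qed
  have zero: "P 0" using scale[OF one, of 0] by simp
  have sum: "P (\<Sum>S\<in>A. gcoeff F S *\<^sub>R gmonom S)" if "finite A" "\<And>S. S \<in> A \<Longrightarrow> finite S" for A
    using that by (induction A) (auto simp: zero intro!: add scale mon)
  have "F = (\<Sum>S\<in>{S. gcoeff F S \<noteq> 0}. gcoeff F S *\<^sub>R gmonom S)"
  proof (rule grassmann_eqI)
    fix T :: "'g set" assume "finite T"
    then have "(\<Sum>S | gcoeff F S \<noteq> 0. gcoeff F S * gcoeff (gmonom S) T) =
        (\<Sum>S | gcoeff F S \<noteq> 0. if T = S then gcoeff F S else 0)"
      by (intro sum.cong) (auto simp: gcoeff_gmonom)
    then show "gcoeff F T = gcoeff (\<Sum>S | gcoeff F S \<noteq> 0. gcoeff F S *\<^sub>R gmonom S) T"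
      by (simp add: gcoeff_sum finite_gcoeff_support)
  qed
  moreover have "P (\<Sum>S\<in>{S. gcoeff F S \<noteq> 0}. gcoeff F S *\<^sub>R gmonom S)"
    by (rule sum) (use finite_gcoeff_support gcoeff_infinite in auto)
  ultimately show ?thesis by simp
qed

text \<open>
  What is needed of even elements: they are central, and the graded Leibniz rule for them carries no
  sign. Working with these two properties instead of a grading makes all products of observables
  commute without further bookkeeping.
\<close>

definition bosonic :: "('g::countable) grassmann \<Rightarrow> bool" where
  "bosonic q \<longleftrightarrow> (\<forall>F. q * F = F * q) \<and>
    (\<forall>x F. left_deriv x (q * F) = left_deriv x q * F + q * left_deriv x F)"

lemma bosonic_commute: "bosonic q \<Longrightarrow> q * F = F * q"
  unfolding bosonic_def by blast

lemma left_deriv_bosonic_mult: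
  "bosonic q \<Longrightarrow> left_deriv x (q * F) = left_deriv x q * F + q * left_deriv x F"
  unfolding bosonic_def by blast

lemma bosonicI:
  assumes "\<And>F. q * F = F * q"
    and "\<And>x F. left_deriv x (q * F) = left_deriv x q * F + q * left_deriv x F"
  shows "bosonic q"
  using assms unfolding bosonic_def by blast

lemma left_deriv_pair_mult:
  "left_deriv x (ggen a * ggen b * F) =
    (if x = a then ggen b * F else 0) - (if x = b then ggen a * F else 0)
      + ggen a * ggen b * left_deriv x F"
  by (simp add: left_deriv_ggen_mult left_deriv_linear mult.assoc right_diff_distrib)

lemma left_deriv_pair:
  "left_deriv x (ggen a * ggen b) = (if x = a then ggen b else 0) - (if x = b then ggen a else 0)"
  using left_deriv_pair_mult[of x a b 1] by (simp add: left_deriv_one)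

lemma bosonic_pair: "bosonic (ggen a * ggen b)"
proof -
  have "ggen a * ggen b * F = F * (ggen a * ggen b)" for F
  proof (induction F rule: grassmann_induct)
    case (gen x F)
    have "ggen a * ggen b * (ggen x * F) = ggen x * (ggen a * ggen b * F)"
      by (simp add: mult.assoc ggen_mult_left_anticommute[of b x] ggen_mult_left_anticommute[of a x])
    then show ?case unfolding gen by (simp only: mult.assoc)
  qed (simp_all add: distrib_left distrib_right)
  then show ?thesis
    by (rule bosonicI) (simp add: left_deriv_pair_mult left_deriv_pair left_diff_distrib)
qed

lemma bosonic_zero: "bosonic 0" and bosonic_one: "bosonic 1"
  by (rule bosonicI; simp add: left_deriv_linear left_deriv_one)+

lemma bosonic_add:
  assumes "bosonic p" "bosonic q"
  shows "bosonic (p + q)"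
proof (rule bosonicI)
  show "(p + q) * F = F * (p + q)" for F
    by (simp add: distrib_left distrib_right assms[THEN bosonic_commute, of F])
  show "left_deriv x ((p + q) * F) = left_deriv x (p + q) * F + (p + q) * left_deriv x F" for x F
    by (simp add: distrib_right left_deriv_linear assms[THEN left_deriv_bosonic_mult])
qed

lemma bosonic_scaleR:
  assumes "bosonic p"
  shows "bosonic (c *\<^sub>R p)"
proof (rule bosonicI)
  show "(c *\<^sub>R p) * F = F * (c *\<^sub>R p)" for F
    by (simp add: bosonic_commute[OF assms, of F])
  show "left_deriv x ((c *\<^sub>R p) * F) = left_deriv x (c *\<^sub>R p) * F + (c *\<^sub>R p) * left_deriv x F" for x F
    by (simp add: left_deriv_linear left_deriv_bosonic_mult[OF assms] scaleR_add_right)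
qed

lemma bosonic_diff: "bosonic p \<Longrightarrow> bosonic q \<Longrightarrow> bosonic (p - q)"
  using bosonic_add[of p "(-1) *\<^sub>R q"] bosonic_scaleR[of q "-1"] by simp

lemma bosonic_mult:
  assumes "bosonic p" "bosonic q"
  shows "bosonic (p * q)"
proof -
  have "p * q * F = F * (p * q)" for F
  proof -
    have "p * q * F = p * (F * q)" by (simp add: mult.assoc bosonic_commute[OF assms(2)])
    also have "\<dots> = F * q * p" by (rule bosonic_commute[OF assms(1)])
    also have "\<dots> = F * (p * q)" by (simp add: mult.assoc bosonic_commute[OF assms(1), of q])
    finally show ?thesis .
  qed
  moreover have "left_deriv x (p * q * F) = left_deriv x (p * q) * F + p * q * left_deriv x F" for x F
    by (simp add: mult.assoc assms[THEN left_deriv_bosonic_mult] distrib_left distrib_right)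
  ultimately show ?thesis by (rule bosonicI)
qed

lemma bosonic_sum: "(\<And>i. i \<in> I \<Longrightarrow> bosonic (f i)) \<Longrightarrow> bosonic (\<Sum>i\<in>I. f i)"
  by (induction I rule: infinite_finite_induct) (auto intro: bosonic_zero bosonic_add)

lemma bosonic_power: "bosonic p \<Longrightarrow> bosonic (p ^ n)"
  by (induction n) (auto intro: bosonic_one bosonic_mult)

lemma bosonic_gexp: "bosonic p \<Longrightarrow> bosonic (gexp p)"
  unfolding gexp_def by (intro bosonic_sum bosonic_scaleR bosonic_power)

lemmas bosonic_intros = bosonic_pair bosonic_zero bosonic_one bosonic_add bosonic_scaleR
  bosonic_diff bosonic_mult bosonic_sum bosonic_power bosonic_gexp

lemma gprod_bosonic_insert:
  assumes "finite A" "a \<notin> A" "\<And>b. b \<in> insert a A \<Longrightarrow> bosonic (f b)"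
  shows "gprod f (insert a A) = f a * gprod f A"
  using assms by (intro gprod_insert) (auto intro: bosonic_commute)

lemma bosonic_gprod: "finite A \<Longrightarrow> (\<And>b. b \<in> A \<Longrightarrow> bosonic (f b)) \<Longrightarrow> bosonic (gprod f A)"
proof (induction A rule: finite_induct)
  case (insert a A)
  then have "gprod f (insert a A) = f a * gprod f A" by (intro gprod_bosonic_insert) auto
  then show ?case using insert by (auto intro: bosonic_mult)
qed (simp add: gprod_empty bosonic_one)

lemma left_deriv_gprod_eq_zero:
  assumes "finite A" "\<And>b. b \<in> A \<Longrightarrow> bosonic (f b)" "\<And>b. b \<in> A \<Longrightarrow> left_deriv x (f b) = 0"
  shows "left_deriv x (gprod f A) = 0"
  using assms
proof (induction A rule: finite_induct)
  case (insert a A)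
  then have "gprod f (insert a A) = f a * gprod f A" by (intro gprod_bosonic_insert) auto
  then show ?case using insert by (simp add: left_deriv_bosonic_mult)
qed (simp add: gprod_empty left_deriv_one)

text \<open>
  Without constant term, the monomials of \<open>F ^ k\<close> use at least \<open>k\<close> different generators, all of them
  among the finitely many occurring in \<open>F\<close>.
\<close>

lemma power_eventually_zero:
  fixes F :: "('g::countable) grassmann"
  assumes "gcoeff F {} = 0"
  shows "\<exists>N. \<forall>k\<ge>N. F ^ k = 0"
proof -
  define U where "U = \<Union> {S. gcoeff F S \<noteq> 0}"
  have U: "finite U"
    unfolding U_def using finite_gcoeff_support gcoeff_infinite by auto
  have supp: "S \<subseteq> U \<and> k \<le> card S" if "finite S" "gcoeff (F ^ k) S \<noteq> 0" for k S
    using that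
  proof (induction k arbitrary: S)
    case 0
    then show ?case by (auto simp: one_grassmann_def gcoeff_gmonom split: if_splits)
  next
    case (Suc k)
    then have "(\<Sum>T\<in>Pow S. (-1) ^ inversions T (S - T) * gcoeff F T * gcoeff (F ^ k) (S - T)) \<noteq> 0"
      by (simp add: times_grassmann_def gcoeff_grassmann_mult)
    then obtain T where "T \<in> Pow S" "(-1) ^ inversions T (S - T) * gcoeff F T * gcoeff (F ^ k) (S - T) \<noteq> 0"
      by (meson sum.neutral)
    then have T: "T \<subseteq> S" "gcoeff F T \<noteq> 0" "gcoeff (F ^ k) (S - T) \<noteq> 0" by auto
    then have "T \<noteq> {}" "T \<subseteq> U" "S - T \<subseteq> U" "k \<le> card (S - T)"
      using assms Suc unfolding U_def by auto
    moreover have "card S = card T + card (S - T)"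
      using T Suc.prems by (metis card_Diff_subset card_mono finite_subset le_add_diff_inverse)
    moreover have "card T > 0"
      using \<open>T \<noteq> {}\<close> T Suc.prems by (meson card_gt_0_iff finite_subset)
    ultimately show ?case by auto
  qed
  have "F ^ k = 0" if "k > card U" for k
  proof (rule grassmann_eqI)
    fix S :: "'g set" assume "finite S"
    then show "gcoeff (F ^ k) S = gcoeff 0 S"
      using supp[of S k] that U card_mono[of U S] by fastforce
  qed
  then show ?thesis by (intro exI[of _ "Suc (card U)"]) auto
qed

lemma gexp_eq_sum:
  assumes "\<And>k. k \<ge> N \<Longrightarrow> F ^ k = 0"
  shows "gexp F = (\<Sum>k<N. (1 / fact k) *\<^sub>R F ^ k)"
  unfolding gexp_def
  by (rule sum.mono_neutral_left) (use assms not_less in auto)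

text \<open>
  As \<open>p\<close> is central with square zero, the binomial expansion of \<open>(p + B) ^ k\<close> stops after the linear
  term \<open>k p B ^ (k - 1)\<close>, and summing gives \<open>exp p = 1 + p\<close> times \<open>exp B\<close>.
\<close>

lemma gexp_add_square_zero:
  assumes p: "bosonic p" "p * p = 0" "gcoeff p {} = 0" and B: "gcoeff B {} = 0"
  shows "gexp (p + B) = (1 + p) * gexp B"
proof -
  have pow: "(p + B) ^ Suc k = B ^ Suc k + real (Suc k) *\<^sub>R (p * B ^ k)" for k
  proof (induction k)
    case (Suc k)
    have 1: "p * (p * X) = 0" for X using p(2) by (metis mult.assoc mult_zero_left)
    have 2: "B * (p * X) = p * (B * X)" for X
      by (simp add: bosonic_commute[OF p(1), of B, symmetric] flip: mult.assoc)
    have "(p + B) ^ Suc (Suc k) = (p + B) * (B ^ Suc k + real (Suc k) *\<^sub>R (p * B ^ k))"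
      using Suc by simp
    also have "\<dots> = B ^ Suc (Suc k) + real (Suc (Suc k)) *\<^sub>R (p * B ^ Suc k)"
      by (simp add: distrib_left distrib_right 1 2 scaleR_add_left scaleR_2)
    finally show ?case .
  qed simp
  obtain N1 where N1: "\<And>k. k \<ge> N1 \<Longrightarrow> B ^ k = 0"
    using power_eventually_zero[OF B] by blast
  obtain N2 where N2: "\<And>k. k \<ge> N2 \<Longrightarrow> (p + B) ^ k = 0"
    using power_eventually_zero[of "p + B"] p(3) B by auto
  define N where "N = max N1 N2"
  have "gexp (p + B) = (\<Sum>k<Suc N. (1 / fact k) *\<^sub>R (p + B) ^ k)"
    by (rule gexp_eq_sum) (use N2 in \<open>auto simp: N_def\<close>)
  also have "\<dots> = 1 + (\<Sum>k<N. (1 / fact (Suc k)) *\<^sub>R (p + B) ^ Suc k)"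
    by (subst sum.lessThan_Suc_shift) simp
  also have "\<dots> = 1 + (\<Sum>k<N. (1 / fact (Suc k)) *\<^sub>R B ^ Suc k) + (\<Sum>k<N. (1 / fact k) *\<^sub>R (p * B ^ k))"
    unfolding pow by (simp add: scaleR_add_right sum.distrib del: power_Suc of_nat_Suc)
  also have "1 + (\<Sum>k<N. (1 / fact (Suc k)) *\<^sub>R B ^ Suc k) = (\<Sum>k<Suc N. (1 / fact k) *\<^sub>R B ^ k)"
    by (subst sum.lessThan_Suc_shift) simp
  also have "\<dots> = gexp B"
    by (rule gexp_eq_sum[symmetric]) (use N1 in \<open>auto simp: N_def\<close>)
  also have "(\<Sum>k<N. (1 / fact k) *\<^sub>R (p * B ^ k)) = p * (\<Sum>k<N. (1 / fact k) *\<^sub>R B ^ k)"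
    by (simp add: sum_distrib_left)
  also have "(\<Sum>k<N. (1 / fact k) *\<^sub>R B ^ k) = gexp B"
    by (rule gexp_eq_sum[symmetric]) (use N1 in \<open>auto simp: N_def\<close>)
  finally show ?thesis by (simp add: distrib_right)
qed

text \<open>
  A prefactor that kills \<open>T\<close> kills every term of the expansion containing \<open>T\<close>. With
  \<open>p = \<psi>\<^sub>v \<psi>bar\<^sub>v\<close> this will delete the vertex \<open>v\<close> from an action.
\<close>

lemma mult_gexp_add_annihilated:
  assumes T: "bosonic T" "p * T = 0" "gcoeff T {} = 0" and B: "gcoeff B {} = 0"
  shows "p * gexp (T + B) = p * gexp B"
proof -
  have pow: "p * (T + B) ^ k = p * B ^ k" for k
  proof (induction k)
    case (Suc k)
    have "p * (T + B) ^ Suc k = p * (T + B) ^ k * (T + B)"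
      by (simp only: power_Suc2 mult.assoc)
    also have "\<dots> = p * B ^ k * (T + B)" by (simp add: Suc)
    also have "\<dots> = p * B ^ k * B + p * T * B ^ k"
      using bosonic_commute[OF T(1), of "B ^ k"] by (simp add: distrib_left mult.assoc)
    also have "\<dots> = p * B ^ Suc k" unfolding T(2) by (simp only: power_Suc2 mult.assoc) simp
    finally show ?case .
  qed simp
  obtain N1 where N1: "\<And>k. k \<ge> N1 \<Longrightarrow> B ^ k = 0"
    using power_eventually_zero[OF B] by blast
  obtain N2 where N2: "\<And>k. k \<ge> N2 \<Longrightarrow> (T + B) ^ k = 0"
    using power_eventually_zero[of "T + B"] T(3) B by auto
  define N where "N = max N1 N2"
  have "gexp (T + B) = (\<Sum>k<N. (1 / fact k) *\<^sub>R (T + B) ^ k)"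
    "gexp B = (\<Sum>k<N. (1 / fact k) *\<^sub>R B ^ k)"
    by (rule gexp_eq_sum; use N1 N2 in \<open>auto simp: N_def\<close>)+
  then show ?thesis by (simp add: sum_distrib_left pow)
qed

lemma left_deriv_sum: "left_deriv x (\<Sum>i\<in>I. f i) = (\<Sum>i\<in>I. left_deriv x (f i))"
  by (induction I rule: infinite_finite_induct) (auto simp: left_deriv_linear)

lemma left_deriv_gexp:
  assumes "bosonic Q" "gcoeff Q {} = 0"
  shows "left_deriv x (gexp Q) = left_deriv x Q * gexp Q"
proof -
  have pow: "left_deriv x (Q ^ Suc k) = real (Suc k) *\<^sub>R (left_deriv x Q * Q ^ k)" for k
  proof (induction k)
    case 0
    then show ?case by simp
  next
    case (Suc k)
    have "left_deriv x (Q ^ Suc (Suc k)) = left_deriv x Q * Q ^ Suc k + Q * left_deriv x (Q ^ Suc k)"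
      using left_deriv_bosonic_mult[OF assms(1), of x "Q ^ Suc k"] by simp
    also have "Q * left_deriv x (Q ^ Suc k) = real (Suc k) *\<^sub>R (left_deriv x Q * Q ^ Suc k)"
      unfolding Suc using bosonic_commute[OF assms(1), of "left_deriv x Q"]
      by (simp add: mult.assoc[symmetric])
    finally show ?case by (simp add: scaleR_add_left scaleR_2)
  qed
  obtain N where N: "\<And>k. k \<ge> N \<Longrightarrow> Q ^ k = 0"
    using power_eventually_zero[OF assms(2)] by blast
  have "left_deriv x (gexp Q) = (\<Sum>k<Suc N. (1 / fact k) *\<^sub>R left_deriv x (Q ^ k))"
    using N by (subst gexp_eq_sum[of "Suc N"]) (auto simp: left_deriv_sum left_deriv_linear)
  also have "\<dots> = (\<Sum>k<N. (1 / fact (Suc k)) *\<^sub>R left_deriv x (Q ^ Suc k))"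
    by (subst sum.lessThan_Suc_shift) (simp add: left_deriv_one)
  also have "\<dots> = (\<Sum>k<N. (1 / fact k) *\<^sub>R (left_deriv x Q * Q ^ k))"
    unfolding pow by (simp del: power_Suc of_nat_Suc)
  also have "\<dots> = left_deriv x Q * gexp Q"
    using N by (subst gexp_eq_sum[of N]) (auto simp: sum_distrib_left)
  finally show ?thesis .
qed

lemma gexp_zero: "gexp (0 :: ('g::countable) grassmann) = 1"
  by (subst gexp_eq_sum[of 1]) (auto simp: power_0_left)

section \<open>Forbidden subconfigurations and burnable configurations\<close>

definition nbr_count :: "(int ^ 'd) set \<Rightarrow> int ^ 'd \<Rightarrow> nat" where
  "nbr_count F v = card {u \<in> F. v \<sim> u}"

definition forbidden :: "(int ^ 'd) set \<Rightarrow> (int ^ 'd \<Rightarrow> nat) \<Rightarrow> bool" where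
  "forbidden F \<rho> \<longleftrightarrow> F \<noteq> {} \<and> (\<forall>v\<in>F. \<rho> v \<le> nbr_count F v)"

text \<open>
  The name refers to the burning algorithm: as long as the set \<open>F\<close> of unburnt sites is nonempty, it is
  not forbidden, so some site has more grains than unburnt neighbours and can burn next.
\<close>

definition burnable :: "(int ^ 'd) set \<Rightarrow> (int ^ 'd \<Rightarrow> nat) \<Rightarrow> (int ^ 'd \<Rightarrow> nat) set" where
  "burnable S D = {\<rho> \<in> (\<Pi>\<^sub>E v\<in>S. {1..D v}). \<forall>F\<subseteq>S. \<not> forbidden F \<rho>}"

lemma neighbours_sym: "u \<sim> v \<longleftrightarrow> v \<sim> u"
proof -
  have "- e \<in> unit_steps" if "e \<in> unit_steps" for e :: "int ^ 'd"
    using that by (auto simp: unit_steps_def)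
  from this[of "u - v"] this[of "v - u"] show ?thesis
    by (auto simp: neighbours_def)
qed

lemma zero_notin_unit_steps: "0 \<notin> (unit_steps :: (int ^ 'd) set)"
proof
  assume "0 \<in> (unit_steps :: (int ^ 'd) set)"
  then obtain i :: 'd where "axis i (1::int) = 0"
    by (auto simp: unit_steps_def)
  then show False by (metis axis_eq_0_iff zero_neq_one)
qed

lemma not_neighbours_refl: "\<not> v \<sim> v"
  using zero_notin_unit_steps by (auto simp: neighbours_def)

lemma neighbours_set: "{w. v \<sim> w} = (\<lambda>e. v + e) ` unit_steps"
  by (force simp: neighbours_def image_iff)

lemma finite_neighbours: "finite {w. v \<sim> w}"
  by (simp add: neighbours_set card_unit_steps)

lemma card_neighbours: "card {w. v \<sim> (w :: int ^ 'd)} = 2 * CARD('d)"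
  unfolding neighbours_set by (subst card_image) (simp_all add: card_unit_steps)

lemma nbr_count_le: "nbr_count F (v :: int ^ 'd) \<le> 2 * CARD('d)"
  unfolding nbr_count_def card_neighbours[of v, symmetric]
  by (intro card_mono finite_neighbours) auto

lemma nbr_count_mono: "F \<subseteq> G \<Longrightarrow> nbr_count F v \<le> nbr_count G v"
  unfolding nbr_count_def by (rule card_mono) (auto intro: finite_subset[OF _ finite_neighbours[of v]])

lemma nbr_count_Un:
  assumes "A \<inter> B = {}"
  shows "nbr_count (A \<union> B) v = nbr_count A v + nbr_count B v"
proof -
  have "{u \<in> A \<union> B. v \<sim> u} = {u \<in> A. v \<sim> u} \<union> {u \<in> B. v \<sim> u}" by auto
  moreover have "finite {u \<in> A. v \<sim> u}" "finite {u \<in> B. v \<sim> u}"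
    by (auto intro: finite_subset[OF _ finite_neighbours[of v]])
  ultimately show ?thesis
    using assms unfolding nbr_count_def by (auto intro!: card_Un_disjoint)
qed

lemma finite_burnable: "finite S \<Longrightarrow> finite (burnable S D)"
  unfolding burnable_def by (rule finite_subset[of _ "\<Pi>\<^sub>E v\<in>S. {1..D v}"]) (auto intro: finite_PiE)

lemma forbidden_cong: "(\<And>v. v \<in> F \<Longrightarrow> \<rho> v = \<rho>' v) \<Longrightarrow> forbidden F \<rho> \<longleftrightarrow> forbidden F \<rho>'"
  by (auto simp: forbidden_def)

text \<open>
  A site whose height exceeds its degree in \<open>S\<close> lies in no forbidden set. Hence the configurations
  with the new maximal height at \<open>v\<close> are determined by an arbitrary burnable configuration on the
  remaining sites.
\<close>

lemma card_burnable_upd: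
  assumes "finite S" "v \<in> S" "nbr_count S v \<le> D v"
  shows "card (burnable S (D(v := Suc (D v)))) = card (burnable S D) + card (burnable (S - {v}) D)"
proof -
  let ?D = "D(v := Suc (D v))" and ?f = "\<lambda>\<rho>. \<rho>(v := Suc (D v))"
  have "burnable S ?D = burnable S D \<union> ?f ` burnable (S - {v}) D" (is "?L = ?A \<union> ?B")
  proof (intro subset_antisym subsetI)
    fix \<rho> assume \<rho>: "\<rho> \<in> ?L"
    show "\<rho> \<in> ?A \<union> ?B"
    proof (cases "\<rho> v = Suc (D v)")
      case True
      let ?r = "restrict \<rho> (S - {v})"
      have "\<not> forbidden F ?r" if "F \<subseteq> S - {v}" for F
        using \<rho> that forbidden_cong[of F ?r \<rho>] by (auto simp: burnable_def subset_eq)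
      moreover have "?r \<in> (\<Pi>\<^sub>E u\<in>S - {v}. {1..D u})"
        using \<rho> by (auto simp: burnable_def PiE_iff split: if_splits)
      ultimately have "?r \<in> burnable (S - {v}) D" by (simp add: burnable_def)
      moreover have "\<rho> = ?f ?r"
        using \<rho> True by (auto simp: burnable_def PiE_iff extensional_def fun_eq_iff)
      ultimately show ?thesis by blast
    next
      case False
      have "\<rho> u \<le> D u" if "u \<in> S" for u
      proof -
        have "\<rho> u \<le> (D(v := Suc (D v))) u"
          using \<rho> that by (auto simp: burnable_def PiE_iff)
        then show ?thesis using False by (cases "u = v") auto
      qed
      then have "\<rho> \<in> ?A" using \<rho> by (auto simp: burnable_def PiE_iff)
      then show ?thesis by blast
    qed
  next
    fix \<rho> assume "\<rho> \<in> ?A \<union> ?B"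
    then show "\<rho> \<in> ?L"
    proof
      assume "\<rho> \<in> ?A"
      then show ?thesis by (force simp: burnable_def PiE_iff)
    next
      assume "\<rho> \<in> ?B"
      then obtain r where r: "r \<in> burnable (S - {v}) D" "\<rho> = ?f r" by auto
      have "\<not> forbidden F \<rho>" if F: "F \<subseteq> S" for F
      proof (cases "v \<in> F")
        case True
        have "nbr_count F v < \<rho> v"
          using nbr_count_mono[OF F, of v] assms(3) r(2) by simp
        then show ?thesis using True by (auto simp: forbidden_def intro!: bexI[of _ v])
      next
        case False
        then show ?thesis
        proof -
          have "F \<subseteq> S - {v}" using F False by blast
          then have "\<not> forbidden F r" using r(1) unfolding burnable_def by blast
          moreover have "forbidden F \<rho> \<longleftrightarrow> forbidden F r"
            by (rule forbidden_cong) (use False r(2) in auto)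
          ultimately show ?thesis by blast
        qed
      qed
      moreover have "\<rho> \<in> (\<Pi>\<^sub>E u\<in>S. {1..?D u})"
        using r assms(2) by (auto simp: burnable_def PiE_iff extensional_def)
      ultimately show ?thesis by (simp add: burnable_def)
    qed
  qed
  moreover have "?A \<inter> ?B = {}"
    using assms(2) by (fastforce simp: burnable_def PiE_iff)
  moreover have "inj_on ?f (burnable (S - {v}) D)"
  proof (rule inj_onI)
    fix r s assume "r \<in> burnable (S - {v}) D" "s \<in> burnable (S - {v}) D" "?f r = ?f s"
    then have rs: "r \<in> extensional (S - {v})" "s \<in> extensional (S - {v})" "?f r = ?f s"
      by (auto simp: burnable_def PiE_iff)
    show "r = s"
    proof
      show "r u = s u" for u
      proof (cases "u = v")
        case True
        then show ?thesis using extensional_arb[OF rs(1), of v] extensional_arb[OF rs(2), of v] by simp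
      next
        case False
        then show ?thesis using fun_cong[OF rs(3), of u] by simp
      qed
    qed
  qed
  ultimately show ?thesis
    using assms(1) by (simp add: card_Un_disjoint finite_burnable card_image)
qed

lemma burnable_no_sink:
  assumes "S \<noteq> {}" "\<And>v. v \<in> S \<Longrightarrow> D v = nbr_count S v"
  shows "burnable S D = {}"
proof -
  have "forbidden S \<rho>" if "\<rho> \<in> (\<Pi>\<^sub>E v\<in>S. {1..D v})" for \<rho>
    using that assms by (force simp: forbidden_def PiE_iff)
  then show ?thesis by (auto simp: burnable_def)
qed

lemma burnable_empty: "burnable {} D = {\<lambda>_. undefined}"
  by (auto simp: burnable_def forbidden_def)

text \<open>
  Subtracting from each height outside \<open>V\<close> the number of neighbours in \<open>V\<close> translates forbidden sets
  into forbidden sets in both directions. A forbidden \<open>F\<close> is never contained in the independent set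
  \<open>V\<close>, and \<open>F - V\<close> stays forbidden. Conversely a forbidden set outside \<open>V\<close> may be enlarged by its
  neighbours in \<open>V\<close>, which have height one and a neighbour in the set.
\<close>

lemma card_burnable_height_one:
  fixes \<Lambda> V :: "(int ^ 'd) set"
  assumes "finite \<Lambda>" "V \<subseteq> \<Lambda>" and indep: "\<And>u v. u \<in> V \<Longrightarrow> v \<in> V \<Longrightarrow> \<not> u \<sim> v"
    and D1: "\<And>v. v \<in> V \<Longrightarrow> 1 \<le> D v"
  shows "card {\<rho> \<in> burnable \<Lambda> D. \<forall>v\<in>V. \<rho> v = 1} =
    card (burnable (\<Lambda> - V) (\<lambda>u. D u - nbr_count V u))"
proof -
  let ?A = "{\<rho> \<in> burnable \<Lambda> D. \<forall>v\<in>V. \<rho> v = 1}"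
  let ?B = "burnable (\<Lambda> - V) (\<lambda>u. D u - nbr_count V u)"
  let ?f = "\<lambda>\<rho>. \<lambda>u\<in>\<Lambda> - V. \<rho> u - nbr_count V u"
  let ?g = "\<lambda>r. \<lambda>u\<in>\<Lambda>. if u \<in> V then 1 else r u + nbr_count V u"
  have to_sub: "\<exists>F'\<subseteq>\<Lambda> - V. forbidden F' (?f \<rho>)"
    if F: "forbidden F \<rho>" "F \<subseteq> \<Lambda>" "\<forall>v\<in>V. \<rho> v = 1" for F and \<rho> :: "int ^ 'd \<Rightarrow> nat"
  proof -
    have "F - V \<noteq> {}"
    proof
      assume sub: "F - V = {}"
      obtain v where v: "v \<in> F" using F by (auto simp: forbidden_def)
      then have "{u \<in> F. v \<sim> u} = {}" using sub indep by blast
      then have "nbr_count F v = 0" unfolding nbr_count_def by (simp only: card.empty)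
      then show False using F v sub by (fastforce simp: forbidden_def)
    qed
    moreover have "?f \<rho> u \<le> nbr_count (F - V) u" if u: "u \<in> F - V" for u
    proof -
      have "\<rho> u \<le> nbr_count ((F - V) \<union> (F \<inter> V)) u"
        using u F by (auto simp: forbidden_def Un_Diff_Int)
      also have "\<dots> \<le> nbr_count (F - V) u + nbr_count V u"
        by (subst nbr_count_Un) (auto intro: nbr_count_mono)
      finally show ?thesis using u F by auto
    qed
    ultimately show ?thesis using F(2) by (intro exI[of _ "F - V"]) (auto simp: forbidden_def)
  qed
  have of_sub: "\<exists>F\<subseteq>\<Lambda>. forbidden F \<rho>"
    if F: "forbidden F' (?f \<rho>)" "F' \<subseteq> \<Lambda> - V" and \<rho>: "\<forall>v\<in>V. \<rho> v = 1"
    for F' and \<rho> :: "int ^ 'd \<Rightarrow> nat"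
  proof -
    define W where "W = {v \<in> V. \<exists>u\<in>F'. v \<sim> u}"
    have dis: "F' \<inter> W = {}" using F by (auto simp: W_def)
    have "\<rho> u \<le> nbr_count (F' \<union> W) u" if u: "u \<in> F' \<union> W" for u
    proof (cases "u \<in> F'")
      case True
      have "{w \<in> V. u \<sim> w} = {w \<in> W. u \<sim> w}"
        using True neighbours_sym[of u] by (auto simp: W_def)
      then have "nbr_count V u = nbr_count W u" by (simp add: nbr_count_def)
      moreover have "\<rho> u - nbr_count V u \<le> nbr_count F' u"
      proof -
        have "?f \<rho> u \<le> nbr_count F' u" using F True unfolding forbidden_def by blast
        then show ?thesis using F True by auto
      qed
      ultimately show ?thesis by (simp add: nbr_count_Un[OF dis])
    next
      case False
      then obtain w where w: "u \<in> V" "w \<in> F'" "u \<sim> w" using u by (auto simp: W_def)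
      have "card {w} \<le> card {w \<in> F' \<union> W. u \<sim> w}"
        using w by (intro card_mono) (auto intro: finite_subset[OF _ finite_neighbours[of u]])
      then show ?thesis using w \<rho> by (simp add: nbr_count_def)
    qed
    then show ?thesis
      using F assms(2) by (intro exI[of _ "F' \<union> W"]) (auto simp: forbidden_def W_def)
  qed
  have fg: "?f (?g r) = r" if "r \<in> ?B" for r
    using that by (auto simp: burnable_def PiE_iff extensional_def fun_eq_iff)
  (* If the subtraction left no grain at u, the singleton {u} would be forbidden. In particular the
     truncated subtraction on nat never loses information. *)
  have f_pos: "nbr_count V u < \<rho> u" if "\<rho> \<in> ?A" "u \<in> \<Lambda> - V" for \<rho> u
  proof (rule ccontr)
    assume "\<not> nbr_count V u < \<rho> u"
    then have "forbidden {u} (?f \<rho>)" using that by (auto simp: forbidden_def)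
    then show False using of_sub[of "{u}" \<rho>] that by (auto simp: burnable_def)
  qed
  have "bij_betw ?f ?A ?B"
  proof (rule bij_betw_byWitness[where f' = ?g])
    show "\<forall>\<rho>\<in>?A. ?g (?f \<rho>) = \<rho>"
    proof
      fix \<rho> assume \<rho>: "\<rho> \<in> ?A"
      have "?g (?f \<rho>) u = \<rho> u" for u
        using \<rho> f_pos[OF \<rho>, of u] assms(2)
        by (cases "u \<in> \<Lambda>") (auto simp: burnable_def PiE_iff extensional_def)
      then show "?g (?f \<rho>) = \<rho>" by blast
    qed
    show "\<forall>r\<in>?B. ?f (?g r) = r" using fg by blast
    show "?f ` ?A \<subseteq> ?B"
    proof (rule image_subsetI)
      fix \<rho> assume \<rho>: "\<rho> \<in> ?A"
      have "\<rho> u \<le> D u" if "u \<in> \<Lambda>" for u using \<rho> that by (auto simp: burnable_def PiE_iff)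
      then have "?f \<rho> \<in> (\<Pi>\<^sub>E u\<in>\<Lambda> - V. {1..D u - nbr_count V u})"
        using f_pos[OF \<rho>] by (auto simp: Suc_le_eq intro!: diff_le_mono)
      moreover have "\<not> forbidden F (?f \<rho>)" if "F \<subseteq> \<Lambda> - V" for F
        using of_sub[of F \<rho>] that \<rho> by (auto simp: burnable_def)
      ultimately show "?f \<rho> \<in> ?B" by (simp add: burnable_def)
    qed
    show "?g ` ?B \<subseteq> ?A"
    proof (rule image_subsetI)
      fix r assume r: "r \<in> ?B"
      have one: "\<forall>v\<in>V. ?g r v = 1" using assms(2) by auto
      have "1 \<le> r u \<and> r u \<le> D u - nbr_count V u" if "u \<in> \<Lambda> - V" for u
        using r that by (auto simp: burnable_def PiE_iff)
      then have "?g r \<in> (\<Pi>\<^sub>E u\<in>\<Lambda>. {1..D u})"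
        using D1 by (fastforce simp: PiE_iff)
      moreover have "\<not> forbidden F (?g r)" if "F \<subseteq> \<Lambda>" for F
      proof
        assume "forbidden F (?g r)"
        from to_sub[OF this that one] obtain F' where "F' \<subseteq> \<Lambda> - V" "forbidden F' (?f (?g r))"
          by blast
        then show False using r unfolding fg[OF r] burnable_def by blast
      qed
      ultimately show "?g r \<in> ?A" using one by (simp add: burnable_def)
    qed
  qed
  then show ?thesis by (rule bij_betw_same_card)
qed

section \<open>Stabilization of sandpiles\<close>

lemma legal_topplings_strong_confluent:
  "strong_confluentp (legal_toppling (\<Lambda> :: (int ^ 'd) set))"
proof
  fix \<eta> \<xi> \<zeta> :: "int ^ 'd \<Rightarrow> nat"
  assume "legal_toppling \<Lambda> \<eta> \<xi>" "legal_toppling \<Lambda> \<eta> \<zeta>"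
  then obtain v w where v: "v \<in> \<Lambda>" "\<eta> v > 2 * CARD('d)" "\<xi> = topple \<Lambda> v \<eta>"
    and w: "w \<in> \<Lambda>" "\<eta> w > 2 * CARD('d)" "\<zeta> = topple \<Lambda> w \<eta>"
    by (auto simp: legal_toppling_def)
  show "\<exists>\<omega>. (legal_toppling \<Lambda>)\<^sup>*\<^sup>* \<xi> \<omega> \<and> (legal_toppling \<Lambda>)\<^sup>=\<^sup>= \<zeta> \<omega>"
  proof (cases "v = w")
    case True
    then show ?thesis using v w by blast
  next
    case False
    have "topple \<Lambda> w \<xi> = topple \<Lambda> v \<zeta>"
      using v w False by (auto simp: topple_def fun_eq_iff)
    moreover have "\<xi> w > 2 * CARD('d)" "\<zeta> v > 2 * CARD('d)"
      using v w False by (auto simp: topple_def)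
    ultimately have "legal_toppling \<Lambda> \<xi> (topple \<Lambda> v \<zeta>)" "legal_toppling \<Lambda> \<zeta> (topple \<Lambda> v \<zeta>)"
      using v(1) w(1) by (auto simp: legal_toppling_def)
    then show ?thesis by blast
  qed
qed

lemma sum_unit_steps:
  "(\<Sum>e\<in>(unit_steps :: (int ^ 'd) set). f e) = (\<Sum>i\<in>UNIV. f (axis i 1) + f (- axis i 1))"
proof -
  have axis: "axis i (1::int) = axis j 1 \<longleftrightarrow> i = j" "axis i (1::int) \<noteq> - axis j 1" for i j :: 'd
    by (auto simp: vec_eq_iff axis_def split: if_splits)
  have eq: "(unit_steps :: (int ^ 'd) set) =
      range (\<lambda>i. axis i 1) \<union> range (\<lambda>i. - axis i 1)"
    by (auto simp: unit_steps_def)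
  have "(\<Sum>e\<in>(unit_steps :: (int ^ 'd) set). f e) =
      (\<Sum>e\<in>range (\<lambda>i::'d. axis i (1::int)). f e) + (\<Sum>e\<in>range (\<lambda>i::'d. - axis i (1::int)). f e)"
    unfolding eq by (rule sum.union_disjoint) (auto simp: axis)
  also have "\<dots> = (\<Sum>i\<in>UNIV. f (axis i 1)) + (\<Sum>i\<in>UNIV. f (- axis i 1))"
    by (simp add: sum.reindex inj_on_def axis)
  finally show ?thesis by (simp add: sum.distrib)
qed

lemma sum_neighbours: "(\<Sum>w | v \<sim> w. f w) = (\<Sum>e\<in>unit_steps. f (v + e))"
  unfolding neighbours_set by (simp add: sum.reindex)

text \<open>
  The function \<open>g w = C - w\<^sub>i\<^sup>2\<close> is strictly superharmonic, and nonnegative near \<open>\<Lambda>\<close> once \<open>C\<close> is large.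
  The total of \<open>g\<close> over all grains therefore decreases with each toppling, also when grains are lost,
  and cannot decrease forever.
\<close>

lemma legal_toppling_terminates:
  assumes "finite (\<Lambda> :: (int ^ 'd) set)"
  shows "\<exists>\<sigma>. (legal_toppling \<Lambda>)\<^sup>*\<^sup>* \<eta> \<sigma> \<and> (\<forall>v\<in>\<Lambda>. \<sigma> v \<le> 2 * CARD('d))"
proof -
  obtain i :: 'd where True by blast \<comment> \<open>an arbitrary coordinate\<close>
  define N where "N = \<Lambda> \<union> (\<Union>v\<in>\<Lambda>. {w. v \<sim> w})"
  have "finite N" using assms finite_neighbours by (auto simp: N_def)
  define C where "C = (\<Sum>w\<in>N. (w $ i)\<^sup>2)"
  define g where "g w = C - (w $ i)\<^sup>2" for w :: "int ^ 'd"
  have g_nonneg: "g w \<ge> 0" if "w \<in> N" for w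
    unfolding g_def C_def using member_le_sum[OF that _ \<open>finite N\<close>, of "\<lambda>w. (w $ i)\<^sup>2"] by simp
  define \<Phi> where "\<Phi> \<eta> = (\<Sum>u\<in>\<Lambda>. int (\<eta> u) * g u)" for \<eta>
  have \<Phi>_nonneg: "\<Phi> \<eta> \<ge> 0" for \<eta>
    unfolding \<Phi>_def by (intro sum_nonneg mult_nonneg_nonneg g_nonneg) (auto simp: N_def)
  have nbr_sum: "(\<Sum>w | v \<sim> w. g w) = 2 * int CARD('d) * g v - 2" for v :: "int ^ 'd"
  proof -
    have "(\<Sum>w | v \<sim> w. g w) = (\<Sum>j\<in>UNIV. 2 * g v - (if j = i then 2 else 0))"
      unfolding sum_neighbours sum_unit_steps
      by (intro sum.cong) (auto simp: g_def axis_def power2_eq_square algebra_simps)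
    also have "\<dots> = 2 * int CARD('d) * g v - 2"
      by (simp add: sum_subtractf)
    finally show ?thesis .
  qed
  have decrease: "\<Phi> \<xi> < \<Phi> \<eta>" if leg: "legal_toppling \<Lambda> \<eta> \<xi>" for \<eta> \<xi>
  proof -
    obtain v where v: "v \<in> \<Lambda>" "\<eta> v > 2 * CARD('d)" "\<xi> = topple \<Lambda> v \<eta>"
      using leg by (auto simp: legal_toppling_def)
    have "\<Phi> \<xi> = (\<Sum>u\<in>\<Lambda>. int (\<eta> u) * g u - (if u = v then 2 * int CARD('d) * g v else 0)
        + (if v \<sim> u then g u else 0))"
      unfolding \<Phi>_def using v(2) not_neighbours_refl[of v]
      by (intro sum.cong) (auto simp: v(3) topple_def of_nat_diff algebra_simps)
    also have "\<dots> = \<Phi> \<eta> - 2 * int CARD('d) * g v + (\<Sum>u | u \<in> \<Lambda> \<and> v \<sim> u. g u)"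
      using assms v(1) by (simp add: \<Phi>_def sum.distrib sum_subtractf sum.If_cases Int_def)
    also have "(\<Sum>u | u \<in> \<Lambda> \<and> v \<sim> u. g u) \<le> (\<Sum>u | v \<sim> u. g u)"
      using v(1) by (intro sum_mono2 finite_neighbours) (auto intro!: g_nonneg simp: N_def)
    finally show ?thesis by (simp add: nbr_sum)
  qed
  show ?thesis
  proof (induction \<eta> rule: measure_induct_rule[of "\<lambda>\<eta>. nat (\<Phi> \<eta>)"])
    case (less \<eta>)
    show ?case
    proof (cases "\<forall>v\<in>\<Lambda>. \<eta> v \<le> 2 * CARD('d)")
      case False
      then obtain v where v: "v \<in> \<Lambda>" "\<eta> v > 2 * CARD('d)" by force
      then have leg: "legal_toppling \<Lambda> \<eta> (topple \<Lambda> v \<eta>)" by (auto simp: legal_toppling_def)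
      have "nat (\<Phi> (topple \<Lambda> v \<eta>)) < nat (\<Phi> \<eta>)"
        using decrease[OF leg] \<Phi>_nonneg[of "topple \<Lambda> v \<eta>"] by linarith
      from less[OF this] leg show ?thesis by (meson converse_rtranclp_into_rtranclp)
    qed auto
  qed
qed

lemma stable_reaches_only_itself:
  assumes "(legal_toppling \<Lambda>)\<^sup>*\<^sup>* \<sigma> \<xi>" "\<forall>v\<in>\<Lambda>. \<sigma> v \<le> 2 * CARD('d)"
  shows "\<xi> = (\<sigma> :: int ^ 'd \<Rightarrow> nat)"
  using assms by (induction rule: converse_rtranclp_induct) (force simp: legal_toppling_def)+

text \<open>
  Topplings at different sites commute and stay legal, hence the topplings form a confluent relation
  and a stable configuration that can be reached is the only one.
\<close>

lemma stabilize_unique: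
  assumes "(legal_toppling \<Lambda>)\<^sup>*\<^sup>* \<eta> \<sigma>" "\<forall>v\<in>\<Lambda>. \<sigma> v \<le> 2 * CARD('d)"
  shows "stabilize \<Lambda> \<eta> = (\<sigma> :: int ^ 'd \<Rightarrow> nat)"
  unfolding stabilize_def
proof (rule the_equality)
  fix \<tau> assume \<tau>: "(legal_toppling \<Lambda>)\<^sup>*\<^sup>* \<eta> \<tau> \<and> (\<forall>v\<in>\<Lambda>. \<tau> v \<le> 2 * CARD('d))"
  obtain \<omega> where "(legal_toppling \<Lambda>)\<^sup>*\<^sup>* \<sigma> \<omega>" "(legal_toppling \<Lambda>)\<^sup>*\<^sup>* \<tau> \<omega>"
    using confluentpD[OF strong_confluentp_imp_confluentp[OF legal_topplings_strong_confluent], of \<Lambda> \<eta> \<sigma> \<tau>]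
      assms(1) \<tau> by blast
  then show "\<tau> = \<sigma>"
    using stable_reaches_only_itself[of \<Lambda> \<sigma> \<omega>] stable_reaches_only_itself[of \<Lambda> \<tau> \<omega>] assms(2) \<tau> by blast
qed (use assms in blast)

lemma stabilize_reachable_stable:
  assumes "finite (\<Lambda> :: (int ^ 'd) set)"
  shows "(legal_toppling \<Lambda>)\<^sup>*\<^sup>* \<eta> (stabilize \<Lambda> \<eta>)" "\<forall>v\<in>\<Lambda>. stabilize \<Lambda> \<eta> v \<le> 2 * CARD('d)"
  using legal_toppling_terminates[OF assms, of \<eta>] stabilize_unique[of \<Lambda> \<eta>] by metis+

section \<open>Adding a grain to a recurrent configuration\<close>

definition add_grain :: "(int ^ 'd) set \<Rightarrow> int ^ 'd \<Rightarrow> (int ^ 'd \<Rightarrow> nat) \<Rightarrow> (int ^ 'd \<Rightarrow> nat)" where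
  "add_grain \<Lambda> v \<eta> = stabilize \<Lambda> (\<eta>(v := \<eta> v + 1))"

lemma add_grain_stable:
  fixes \<eta> :: "int ^ 'd \<Rightarrow> nat"
  assumes "\<eta> \<in> stable_configs \<Lambda>" "\<eta> v < 2 * CARD('d)"
  shows "add_grain \<Lambda> v \<eta> = \<eta>(v := \<eta> v + 1)"
  unfolding add_grain_def
  by (rule stabilize_unique) (use assms in \<open>auto simp: stable_configs_def PiE_iff\<close>)

text \<open>
  If \<open>F\<close> is forbidden after the toppling of \<open>v\<close>, then \<open>F - {v}\<close> was forbidden before: a neighbour of
  \<open>v\<close> in it had one grain less and loses the neighbour \<open>v\<close> from the set, and nothing changes for the
  other sites. And \<open>F = {v}\<close> is impossible, because a legal toppling leaves a grain at \<open>v\<close>.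
\<close>

lemma legal_toppling_no_forbidden:
  fixes \<eta> \<xi> :: "int ^ 'd \<Rightarrow> nat"
  assumes "legal_toppling \<Lambda> \<eta> \<xi>" and no: "\<forall>F\<subseteq>\<Lambda>. \<not> forbidden F \<eta>"
  shows "\<forall>F\<subseteq>\<Lambda>. \<not> forbidden F \<xi>"
proof (intro allI impI notI)
  fix F assume F: "F \<subseteq> \<Lambda>" "forbidden F \<xi>"
  obtain v where v: "v \<in> \<Lambda>" "\<eta> v > 2 * CARD('d)" "\<xi> = topple \<Lambda> v \<eta>"
    using assms(1) by (auto simp: legal_toppling_def)
  have "\<eta> u \<le> nbr_count (F - {v}) u" if u: "u \<in> F - {v}" for u
  proof -
    have "\<xi> u = \<eta> u + (if v \<sim> u then 1 else 0)"
      using u F by (auto simp: v(3) topple_def)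
    moreover have "\<xi> u \<le> nbr_count F u" using F u by (auto simp: forbidden_def)
    moreover have "nbr_count F u \<le> nbr_count (F - {v}) u + nbr_count {v} u"
      using nbr_count_Un[of "F - {v}" "{v}" u] nbr_count_mono[of F "(F - {v}) \<union> {v}" u] by auto
    moreover have "nbr_count {v} u = (if v \<sim> u then 1 else 0)"
    proof -
      have "{w \<in> {v}. u \<sim> w} = (if v \<sim> u then {v} else {})"
        using neighbours_sym[of u v] by auto
      then show ?thesis by (simp add: nbr_count_def)
    qed
    ultimately show ?thesis by (auto split: if_splits)
  qed
  then have "F - {v} \<noteq> {} \<Longrightarrow> forbidden (F - {v}) \<eta>"
    by (simp add: forbidden_def)
  moreover have "\<not> forbidden (F - {v}) \<eta>" using no F(1) by blast
  ultimately have "F - {v} = {}" by blast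
  then have "F = {v}" using F(2) unfolding forbidden_def by blast
  moreover have "nbr_count {v} v = 0"
    using not_neighbours_refl[of v] by (auto simp: nbr_count_def)
  moreover have "\<xi> v > 0" using v by (simp add: topple_def)
  ultimately show False using F(2) unfolding forbidden_def by simp
qed

lemma toppling_invariant:
  fixes \<eta> \<sigma> :: "int ^ 'd \<Rightarrow> nat"
  assumes "(legal_toppling \<Lambda>)\<^sup>*\<^sup>* \<eta> \<sigma>" "\<eta> \<in> (\<Pi>\<^sub>E v\<in>\<Lambda>. {1..})"
  shows "\<sigma> \<in> (\<Pi>\<^sub>E v\<in>\<Lambda>. {1..})"
  using assms by (induction rule: rtranclp_induct) (auto simp: legal_toppling_def topple_def PiE_iff)

lemma add_grain_in_stable_configs:
  fixes \<eta> :: "int ^ 'd \<Rightarrow> nat"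
  assumes "finite \<Lambda>" "v \<in> \<Lambda>" "\<eta> \<in> stable_configs \<Lambda>"
  shows "add_grain \<Lambda> v \<eta> \<in> stable_configs \<Lambda>"
proof -
  have "\<eta>(v := \<eta> v + 1) \<in> (\<Pi>\<^sub>E v\<in>\<Lambda>. {1..})"
    using assms by (auto simp: stable_configs_def PiE_iff extensional_def)
  then have "add_grain \<Lambda> v \<eta> \<in> (\<Pi>\<^sub>E v\<in>\<Lambda>. {1..})"
    unfolding add_grain_def by (rule toppling_invariant[OF stabilize_reachable_stable(1)[OF assms(1)]])
  then show ?thesis
    using stabilize_reachable_stable(2)[OF assms(1)]
    by (auto simp: stable_configs_def PiE_iff add_grain_def)
qed

text \<open>
  By \<open>stationary_is_uniform\<close> below, these are the configurations charged by the stationary measure,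
  that is, the recurrent configurations of the Markov chain.
\<close>

abbreviation recurrent :: "(int ^ 'd) set \<Rightarrow> (int ^ 'd \<Rightarrow> nat) set" where
  "recurrent \<Lambda> \<equiv> burnable \<Lambda> (\<lambda>_. 2 * CARD('d))"

lemma recurrent_alt: "recurrent \<Lambda> = {\<rho> \<in> stable_configs \<Lambda>. \<forall>F\<subseteq>\<Lambda>. \<not> forbidden F \<rho>}"
  by (simp add: burnable_def stable_configs_def)

lemma add_grain_recurrent:
  fixes \<eta> :: "int ^ 'd \<Rightarrow> nat"
  assumes "finite \<Lambda>" "v \<in> \<Lambda>" "\<eta> \<in> recurrent \<Lambda>"
  shows "add_grain \<Lambda> v \<eta> \<in> recurrent \<Lambda>"
proof -
  have "\<not> forbidden F (\<eta>(v := \<eta> v + 1))" if "F \<subseteq> \<Lambda>" for F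
  proof
    assume "forbidden F (\<eta>(v := \<eta> v + 1))"
    moreover have "\<eta> u \<le> (\<eta>(v := \<eta> v + 1)) u" for u by simp
    ultimately have "forbidden F \<eta>"
      unfolding forbidden_def using order_trans by blast
    then show False using assms(3) that by (auto simp: burnable_def)
  qed
  moreover have "\<forall>F\<subseteq>\<Lambda>. \<not> forbidden F \<sigma>"
    if "(legal_toppling \<Lambda>)\<^sup>*\<^sup>* \<xi> \<sigma>" "\<forall>F\<subseteq>\<Lambda>. \<not> forbidden F \<xi>" for \<xi> \<sigma> :: "int ^ 'd \<Rightarrow> nat"
    using that by (induction rule: rtranclp_induct) (blast dest: legal_toppling_no_forbidden)+
  ultimately have "\<forall>F\<subseteq>\<Lambda>. \<not> forbidden F (add_grain \<Lambda> v \<eta>)"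
    using stabilize_reachable_stable(1)[OF assms(1)] unfolding add_grain_def by blast
  then show ?thesis
    using add_grain_in_stable_configs[OF assms(1,2)] assms(3) by (simp add: recurrent_alt)
qed

text \<open>
  The witness \<open>m\<close> is the odometer, the number of topplings at each site.
\<close>

lemma topplings_laplacian:
  fixes \<eta> \<sigma> :: "int ^ 'd \<Rightarrow> nat"
  assumes "(legal_toppling \<Lambda>)\<^sup>*\<^sup>* \<eta> \<sigma>"
  shows "\<exists>m :: int ^ 'd \<Rightarrow> int. (\<forall>u. u \<notin> \<Lambda> \<longrightarrow> m u = 0) \<and>
    (\<forall>u\<in>\<Lambda>. int (\<sigma> u) = int (\<eta> u) - 2 * int CARD('d) * m u + (\<Sum>w | u \<sim> w. m w))"
  using assms
proof (induction rule: rtranclp_induct)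
  case base
  show ?case by (rule exI[of _ "\<lambda>_. 0"]) simp
next
  case (step \<xi> \<sigma>)
  then obtain m where m: "\<And>u. u \<notin> \<Lambda> \<Longrightarrow> m u = 0"
    "\<And>u. u \<in> \<Lambda> \<Longrightarrow> int (\<xi> u) = int (\<eta> u) - 2 * int CARD('d) * m u + (\<Sum>w | u \<sim> w. m w)"
    by blast
  obtain v where v: "v \<in> \<Lambda>" "\<xi> v > 2 * CARD('d)" "\<sigma> = topple \<Lambda> v \<xi>"
    using step by (auto simp: legal_toppling_def)
  let ?m = "\<lambda>u. m u + (if u = v then 1 else 0)"
  have "int (\<sigma> u) = int (\<eta> u) - 2 * int CARD('d) * ?m u + (\<Sum>w | u \<sim> w. ?m w)" if "u \<in> \<Lambda>" for u
  proof -
    have "(\<Sum>w | u \<sim> w. ?m w) = (\<Sum>w | u \<sim> w. m w) + (if u \<sim> v then 1 else 0)"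
      by (simp add: sum.distrib finite_neighbours)
    then show ?thesis
      using m(2)[OF that] that v not_neighbours_refl[of v] neighbours_sym[of u v]
      by (auto simp: topple_def of_nat_diff algebra_simps)
  qed
  then show ?case using m(1) v(1) by (intro exI[of _ ?m]) auto
qed

text \<open>
  Suppose \<open>m\<close> has a positive maximum, attained on \<open>F\<close>. Each site of \<open>F\<close> loses by the shift at least
  one grain for each of its neighbours outside \<open>F\<close>. It had at most \<open>2d\<close> grains and has \<open>2d\<close>
  neighbours, so at most as many grains remain as it has neighbours in \<open>F\<close>. So \<open>F\<close> is forbidden for \<open>\<rho>'\<close>.
\<close>

lemma laplacian_shift_nonpos:
  fixes \<rho> \<rho>' :: "int ^ 'd \<Rightarrow> nat"
  assumes "finite \<Lambda>" and \<rho>: "\<rho> \<in> stable_configs \<Lambda>" and \<rho>': "\<rho>' \<in> recurrent \<Lambda>"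
    and m: "\<And>u. u \<notin> \<Lambda> \<Longrightarrow> m u = 0"
    "\<And>u. u \<in> \<Lambda> \<Longrightarrow> int (\<rho>' u) = int (\<rho> u) - 2 * int CARD('d) * m u + (\<Sum>w | u \<sim> w. m w)"
  shows "m u \<le> (0 :: int)"
proof (rule ccontr)
  assume u: "\<not> m u \<le> 0"
  then have "u \<in> \<Lambda>" using m(1)[of u] by fastforce
  define M where "M = Max (m ` \<Lambda>)"
  define F where "F = {v \<in> \<Lambda>. m v = M}"
  have le: "m v \<le> M" if "v \<in> \<Lambda>" for v using that assms(1) by (simp add: M_def)
  have "M > 0" using u le[OF \<open>u \<in> \<Lambda>\<close>] by linarith
  have "M \<in> m ` \<Lambda>" unfolding M_def using assms(1) \<open>u \<in> \<Lambda>\<close> by (intro Max_in) auto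
  then have "F \<noteq> {}" by (auto simp: F_def)
  moreover have "\<rho>' v \<le> nbr_count F v" if v: "v \<in> F" for v
  proof -
    have "m w \<le> M - 1 + (if w \<in> F then 1 else 0)" for w
      using le[of w] m(1)[of w] \<open>M > 0\<close> by (cases "w \<in> \<Lambda>") (auto simp: F_def)
    then have "(\<Sum>w | v \<sim> w. m w) \<le> (\<Sum>w | v \<sim> w. M - 1 + (if w \<in> F then 1 else 0))"
      by (intro sum_mono)
    also have "\<dots> = int (card {w. v \<sim> w}) * (M - 1) + int (nbr_count F v)"
      by (simp add: sum.distrib finite_neighbours sum.If_cases nbr_count_def Int_def conj_commute)
    finally have "(\<Sum>w | v \<sim> w. m w) \<le> 2 * int CARD('d) * (M - 1) + int (nbr_count F v)"
      by (simp add: card_neighbours)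
    moreover have "m v = M" "int (\<rho> v) \<le> 2 * int CARD('d)"
      using v \<rho> by (auto simp: F_def stable_configs_def PiE_iff)
    ultimately show ?thesis
      using m(2)[of v] v by (simp add: F_def right_diff_distrib)
  qed
  ultimately have "forbidden F \<rho>'" unfolding forbidden_def by blast
  moreover have "F \<subseteq> \<Lambda>" by (auto simp: F_def)
  ultimately show False using \<rho>' unfolding burnable_def by blast
qed

text \<open>
  Configurations with the same image differ by a Laplacian shift. Applying
  \<open>laplacian_shift_nonpos\<close> in both directions, the shift vanishes: a class modulo the Laplacian
  contains at most one recurrent configuration.
\<close>

lemma add_grain_inj_on_recurrent:
  fixes \<Lambda> :: "(int ^ 'd) set"
  assumes "finite \<Lambda>"
  shows "inj_on (add_grain \<Lambda> v) (recurrent \<Lambda>)"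
proof (rule inj_onI)
  fix \<rho> \<rho>' assume \<rho>: "\<rho> \<in> recurrent \<Lambda>" "\<rho>' \<in> recurrent \<Lambda>" "add_grain \<Lambda> v \<rho> = add_grain \<Lambda> v \<rho>'"
  obtain m where m: "\<And>u. u \<notin> \<Lambda> \<Longrightarrow> m u = (0::int)"
    "\<And>u. u \<in> \<Lambda> \<Longrightarrow> int (add_grain \<Lambda> v \<rho> u) = int ((\<rho>(v := \<rho> v + 1)) u) - 2 * int CARD('d) * m u + (\<Sum>w | u \<sim> w. m w)"
    using topplings_laplacian[OF stabilize_reachable_stable(1)[OF assms]] unfolding add_grain_def by metis
  obtain m' where m': "\<And>u. u \<notin> \<Lambda> \<Longrightarrow> m' u = (0::int)"
    "\<And>u. u \<in> \<Lambda> \<Longrightarrow> int (add_grain \<Lambda> v \<rho>' u) = int ((\<rho>'(v := \<rho>' v + 1)) u) - 2 * int CARD('d) * m' u + (\<Sum>w | u \<sim> w. m' w)"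
    using topplings_laplacian[OF stabilize_reachable_stable(1)[OF assms]] unfolding add_grain_def by metis
  let ?k = "\<lambda>u. m u - m' u" and ?k' = "\<lambda>u. m' u - m u"
  have k: "int (\<rho>' u) = int (\<rho> u) - 2 * int CARD('d) * ?k u + (\<Sum>w | u \<sim> w. ?k w)"
    and k': "int (\<rho> u) = int (\<rho>' u) - 2 * int CARD('d) * ?k' u + (\<Sum>w | u \<sim> w. ?k' w)"
    if "u \<in> \<Lambda>" for u
    using m(2)[OF that] m'(2)[OF that] \<rho>(3)
    by (auto simp: sum_subtractf algebra_simps split: if_splits)
  have "?k u \<le> 0" "?k' u \<le> 0" for u
    by (rule laplacian_shift_nonpos[OF assms, of \<rho> \<rho>' ?k] laplacian_shift_nonpos[OF assms, of \<rho>' \<rho> ?k'];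
        use \<rho> k k' m(1) m'(1) in \<open>simp add: recurrent_alt\<close>)+
  then have "?k u = 0" for u by (meson diff_ge_0_iff_ge le_iff_diff_le_0 order_antisym)
  then have "\<rho>' u = \<rho> u" if "u \<in> \<Lambda>" for u
    using k[OF that] by simp
  then show "\<rho> = \<rho>'"
    using \<rho>(1,2) by (intro extensionalityI[of \<rho> \<Lambda>]) (auto simp: burnable_def PiE_iff)
qed

lemma bij_betw_add_grain:
  assumes "finite \<Lambda>" "v \<in> \<Lambda>"
  shows "bij_betw (add_grain \<Lambda> v) (recurrent \<Lambda>) (recurrent \<Lambda>)"
  unfolding bij_betw_def
proof (intro conjI endo_inj_surj)
  show "add_grain \<Lambda> v ` recurrent \<Lambda> \<subseteq> recurrent \<Lambda>"
    using add_grain_recurrent[OF assms] by blast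
qed (use assms in \<open>auto intro: finite_burnable add_grain_inj_on_recurrent\<close>)

definition full_config :: "(int ^ 'd) set \<Rightarrow> int ^ 'd \<Rightarrow> nat" where
  "full_config \<Lambda> = (\<lambda>u\<in>\<Lambda>. 2 * CARD('d))"

text \<open>
  A finite set cannot be forbidden for the full configuration: a site of \<open>F\<close> that is extremal in
  some coordinate direction has a neighbour outside \<open>F\<close>.
\<close>

lemma full_config_recurrent:
  fixes \<Lambda> :: "(int ^ 'd) set"
  assumes "finite \<Lambda>"
  shows "full_config \<Lambda> \<in> recurrent \<Lambda>"
proof -
  have "\<not> forbidden F (full_config \<Lambda>)" if F: "F \<subseteq> \<Lambda>" for F
  proof
    assume forb: "forbidden F (full_config \<Lambda>)"
    then have "F \<noteq> {}" "finite F" using F assms by (auto simp: forbidden_def intro: finite_subset)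
    obtain i :: 'd where True by blast \<comment> \<open>an arbitrary coordinate\<close>
    have "Max ((\<lambda>v. v $ i) ` F) \<in> (\<lambda>v. v $ i) ` F"
      using \<open>F \<noteq> {}\<close> \<open>finite F\<close> by (intro Max_in) auto
    then obtain v where v: "v \<in> F" "v $ i = Max ((\<lambda>v. v $ i) ` F)" by auto
    have max: "u $ i \<le> v $ i" if "u \<in> F" for u
      using that \<open>finite F\<close> by (simp add: v(2))
    have "v + axis i 1 \<notin> F" using max[of "v + axis i 1"] by (auto simp: axis_def)
    moreover have "v \<sim> v + axis i 1" by (auto simp: neighbours_def unit_steps_def)
    ultimately have "{u \<in> F. v \<sim> u} \<subset> {u. v \<sim> u}" by auto
    then have "nbr_count F v < 2 * CARD('d)"
      unfolding nbr_count_def card_neighbours[of v, symmetric]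
      by (rule psubset_card_mono[OF finite_neighbours])
    moreover have "full_config \<Lambda> v \<le> nbr_count F v" "full_config \<Lambda> v = 2 * CARD('d)"
      using forb v F by (auto simp: forbidden_def full_config_def)
    ultimately show False by simp
  qed
  moreover have "full_config \<Lambda> \<in> stable_configs \<Lambda>"
    by (auto simp: full_config_def stable_configs_def Suc_le_eq)
  ultimately show ?thesis by (simp add: recurrent_alt)
qed

lemma finite_stable_configs: "finite \<Lambda> \<Longrightarrow> finite (stable_configs \<Lambda>)"
  by (auto simp: stable_configs_def intro: finite_PiE)

text \<open>
  A member of \<open>C\<close> with the largest number of grains must be full, as a grain added to a site that is
  not full causes no toppling.
\<close>

lemma full_config_reached:
  fixes \<Lambda> :: "(int ^ 'd) set"
  assumes "finite \<Lambda>" "C \<subseteq> stable_configs \<Lambda>" "C \<noteq> {}"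
    and closed: "\<And>\<eta> v. \<eta> \<in> C \<Longrightarrow> v \<in> \<Lambda> \<Longrightarrow> add_grain \<Lambda> v \<eta> \<in> C"
  shows "full_config \<Lambda> \<in> C"
proof -
  let ?s = "\<lambda>\<eta>. \<Sum>v\<in>\<Lambda>. \<eta> v"
  have "finite C" using assms finite_stable_configs finite_subset by blast
  then have "Max (?s ` C) \<in> ?s ` C" using assms(3) by (intro Max_in) auto
  then obtain \<eta> where \<eta>: "\<eta> \<in> C" "?s \<eta> = Max (?s ` C)" by auto
  have max: "?s \<xi> \<le> ?s \<eta>" if "\<xi> \<in> C" for \<xi>
    using that \<open>finite C\<close> by (simp add: \<eta>(2))
  have "\<eta> v = 2 * CARD('d)" if v: "v \<in> \<Lambda>" for v
  proof (rule ccontr)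
    assume "\<eta> v \<noteq> 2 * CARD('d)"
    moreover have "\<eta> v \<le> 2 * CARD('d)"
      using \<eta>(1) assms(2) v by (auto simp: stable_configs_def PiE_iff)
    ultimately have "add_grain \<Lambda> v \<eta> = \<eta>(v := \<eta> v + 1)"
      using \<eta>(1) assms(2) by (intro add_grain_stable) auto
    then have "\<eta>(v := \<eta> v + 1) \<in> C" using closed[OF \<eta>(1) v] by simp
    moreover have "?s (\<eta>(v := \<eta> v + 1)) = Suc (?s \<eta>)"
      using assms(1) v by (simp add: sum.remove[of \<Lambda> v])
    ultimately show False using max by fastforce
  qed
  then have "\<eta> = full_config \<Lambda>"
    using \<eta>(1) assms(2)
    by (intro extensionalityI[of \<eta> \<Lambda>]) (auto simp: full_config_def stable_configs_def PiE_iff)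
  then show ?thesis using \<eta>(1) by simp
qed

section \<open>The stationary measure\<close>

lemma pmf_sandpile_step:
  fixes \<Lambda> :: "(int ^ 'd) set"
  assumes "finite \<Lambda>" "\<Lambda> \<noteq> {}" "finite X" "set_pmf \<pi> \<subseteq> X"
  shows "real (card \<Lambda>) * pmf (bind_pmf \<pi> (sandpile_kernel \<Lambda>)) \<sigma> =
    (\<Sum>\<eta>\<in>X. \<Sum>v\<in>\<Lambda>. if add_grain \<Lambda> v \<eta> = \<sigma> then pmf \<pi> \<eta> else 0)"
proof -
  have kernel: "real (card \<Lambda>) * pmf (sandpile_kernel \<Lambda> \<eta>) \<sigma> =
      (\<Sum>v\<in>\<Lambda>. if add_grain \<Lambda> v \<eta> = \<sigma> then 1 else 0)" for \<eta>
  proof -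
    have "pmf (sandpile_kernel \<Lambda> \<eta>) \<sigma> =
        measure (measure_pmf (pmf_of_set \<Lambda>)) ((\<lambda>v. add_grain \<Lambda> v \<eta>) -` {\<sigma>})"
      by (simp add: sandpile_kernel_def pmf_map add_grain_def)
    also have "\<dots> = real (card (\<Lambda> \<inter> (\<lambda>v. add_grain \<Lambda> v \<eta>) -` {\<sigma>})) / real (card \<Lambda>)"
      using assms by (intro measure_pmf_of_set) auto
    finally show ?thesis
      using assms by (simp add: sum.If_cases vimage_def Int_def)
  qed
  have "pmf (bind_pmf \<pi> (sandpile_kernel \<Lambda>)) \<sigma> = (\<Sum>\<eta>\<in>X. pmf \<pi> \<eta> * pmf (sandpile_kernel \<Lambda> \<eta>) \<sigma>)"
    unfolding pmf_bind using assms
    by (subst integral_measure_pmf[OF assms(3)]) auto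
  then have "real (card \<Lambda>) * pmf (bind_pmf \<pi> (sandpile_kernel \<Lambda>)) \<sigma> =
      (\<Sum>\<eta>\<in>X. pmf \<pi> \<eta> * (real (card \<Lambda>) * pmf (sandpile_kernel \<Lambda> \<eta>) \<sigma>))"
    by (simp add: sum_distrib_left mult_ac)
  then show ?thesis
    unfolding kernel by (simp add: sum_distrib_left if_distrib cong: if_cong)
qed

lemma stationary_closed:
  fixes \<Lambda> :: "(int ^ 'd) set"
  assumes "finite \<Lambda>" "sandpile_stationary \<Lambda> \<pi>" "\<eta> \<in> set_pmf \<pi>" "v \<in> \<Lambda>"
  shows "add_grain \<Lambda> v \<eta> \<in> set_pmf \<pi>"
proof -
  have "add_grain \<Lambda> v \<eta> \<in> set_pmf (sandpile_kernel \<Lambda> \<eta>)"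
  proof -
    have "set_pmf (pmf_of_set \<Lambda>) = \<Lambda>" using assms(1,4) by (intro set_pmf_of_set) auto
    then show ?thesis using assms(4) unfolding sandpile_kernel_def add_grain_def by simp
  qed
  then have "add_grain \<Lambda> v \<eta> \<in> set_pmf (bind_pmf \<pi> (sandpile_kernel \<Lambda>))"
    using assms(3) unfolding set_bind_pmf by blast
  then show ?thesis using assms(2) unfolding sandpile_stationary_def by (simp only:)
qed

text \<open>
  The recurrent configurations are closed under adding grains, so by stationarity no mass may flow into
  them from outside. The part of the support outside would then be closed as well, and contain the full
  configuration, which is recurrent.
\<close>

lemma stationary_supported_on_recurrent:
  fixes \<Lambda> :: "(int ^ 'd) set"
  assumes "finite \<Lambda>" "\<Lambda> \<noteq> {}" "sandpile_stationary \<Lambda> \<pi>"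
  shows "set_pmf \<pi> \<subseteq> recurrent \<Lambda>"
proof (rule ccontr)
  assume notsub: "\<not> ?thesis"
  let ?X = "stable_configs \<Lambda>" and ?R = "recurrent \<Lambda>"
  have X: "finite ?X" "set_pmf \<pi> \<subseteq> ?X" and R: "?R \<subseteq> ?X" "finite ?R"
    using assms finite_stable_configs[OF assms(1)] finite_burnable[OF assms(1)]
    by (auto simp: sandpile_stationary_def recurrent_alt)
  let ?hit = "\<lambda>\<eta>. \<Sum>v\<in>\<Lambda>. if add_grain \<Lambda> v \<eta> \<in> ?R then pmf \<pi> \<eta> else 0"
  have "real (card \<Lambda>) * (\<Sum>\<sigma>\<in>?R. pmf \<pi> \<sigma>) =
      (\<Sum>\<sigma>\<in>?R. \<Sum>\<eta>\<in>?X. \<Sum>v\<in>\<Lambda>. if add_grain \<Lambda> v \<eta> = \<sigma> then pmf \<pi> \<eta> else 0)"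
    using assms(3) pmf_sandpile_step[OF assms(1,2) X]
    by (simp add: sandpile_stationary_def sum_distrib_left)
  also have "\<dots> = (\<Sum>\<eta>\<in>?X. \<Sum>v\<in>\<Lambda>. \<Sum>\<sigma>\<in>?R. if add_grain \<Lambda> v \<eta> = \<sigma> then pmf \<pi> \<eta> else 0)"
    by (subst sum.swap, rule sum.cong[OF refl], subst sum.swap) simp
  also have "\<dots> = (\<Sum>\<eta>\<in>?X. ?hit \<eta>)"
    using R(2) by simp
  also have "\<dots> = (\<Sum>\<eta>\<in>?R. ?hit \<eta>) + (\<Sum>\<eta>\<in>?X - ?R. ?hit \<eta>)"
    by (subst sum.subset_diff[OF R(1) X(1)]) (rule add.commute)
  also have "(\<Sum>\<eta>\<in>?R. ?hit \<eta>) = (\<Sum>\<eta>\<in>?R. real (card \<Lambda>) * pmf \<pi> \<eta>)"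
    using add_grain_recurrent[OF assms(1)] by (intro sum.cong) auto
  finally have "(\<Sum>\<eta>\<in>?X - ?R. ?hit \<eta>) = 0" by (simp add: sum_distrib_left)
  then have hit0: "?hit \<eta> = 0" if "\<eta> \<in> ?X - ?R" for \<eta>
    using that X by (subst (asm) sum_nonneg_eq_0_iff) (auto intro!: sum_nonneg)
  have "full_config \<Lambda> \<in> set_pmf \<pi> - ?R"
  proof (rule full_config_reached[OF assms(1)])
    fix \<eta> v assume \<eta>: "\<eta> \<in> set_pmf \<pi> - ?R" and v: "v \<in> \<Lambda>"
    have "?hit \<eta> = 0" using hit0 \<eta> X by blast
    then have "(if add_grain \<Lambda> v \<eta> \<in> ?R then pmf \<pi> \<eta> else 0) = 0"
      using v assms(1) by (subst (asm) sum_nonneg_eq_0_iff) auto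
    then show "add_grain \<Lambda> v \<eta> \<in> set_pmf \<pi> - ?R"
      using \<eta> stationary_closed[OF assms(1,3) _ v, of \<eta>] by (auto simp: set_pmf_iff split: if_splits)
  qed (use X notsub in auto)
  then show False using full_config_recurrent[OF assms(1)] by blast
qed

text \<open>
  The operators \<open>add_grain \<Lambda> v\<close> permute the recurrent configurations and the density \<open>f\<close> is the average
  of its images under these permutations. Hence the sum of \<open>(f (add_grain \<Lambda> v \<sigma>) - f \<sigma>)\<^sup>2\<close> over
  \<open>v\<close> and \<open>\<sigma>\<close> is zero when expanded: by bijectivity the squares contribute twice the squared norm of
  \<open>f\<close> for each \<open>v\<close>, and by stationarity the cross terms take away the same amount. So \<open>f\<close> is
  invariant, and each of its level sets is closed under adding grains and contains the full
  configuration.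
\<close>

lemma stationary_is_uniform:
  fixes \<Lambda> :: "(int ^ 'd) set"
  assumes "finite \<Lambda>" "\<Lambda> \<noteq> {}" "sandpile_stationary \<Lambda> \<pi>"
  shows "\<pi> = pmf_of_set (recurrent \<Lambda>)"
proof -
  let ?R = "recurrent \<Lambda>" and ?f = "pmf \<pi>" and ?n = "real (card \<Lambda>)"
  have R: "finite ?R" "?R \<noteq> {}" using full_config_recurrent[OF assms(1)] assms(1) finite_burnable by auto
  have supp: "set_pmf \<pi> \<subseteq> ?R" by (rule stationary_supported_on_recurrent[OF assms])
  have step: "?n * ?f \<tau> = (\<Sum>\<sigma>\<in>?R. \<Sum>v\<in>\<Lambda>. if add_grain \<Lambda> v \<sigma> = \<tau> then ?f \<sigma> else 0)" for \<tau>
    using pmf_sandpile_step[OF assms(1,2) R(1) supp, of \<tau>] assms(3) by (simp add: sandpile_stationary_def)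
  have "(\<Sum>\<sigma>\<in>?R. \<Sum>v\<in>\<Lambda>. ?f (add_grain \<Lambda> v \<sigma>) * ?f \<sigma>) =
      (\<Sum>\<sigma>\<in>?R. \<Sum>v\<in>\<Lambda>. \<Sum>\<tau>\<in>?R. ?f \<tau> * (if add_grain \<Lambda> v \<sigma> = \<tau> then ?f \<sigma> else 0))"
    using R(1) add_grain_recurrent[OF assms(1)]
    by (intro sum.cong refl) (simp add: if_distrib cong: if_cong)
  also have "\<dots> = (\<Sum>\<tau>\<in>?R. ?f \<tau> * (\<Sum>\<sigma>\<in>?R. \<Sum>v\<in>\<Lambda>. if add_grain \<Lambda> v \<sigma> = \<tau> then ?f \<sigma> else 0))"
    unfolding sum_distrib_left
    by (subst sum.swap[of _ ?R ?R], rule sum.cong[OF refl], subst sum.swap) simp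
  also have "\<dots> = ?n * (\<Sum>\<tau>\<in>?R. ?f \<tau> ^ 2)"
    unfolding step[symmetric] by (simp add: sum_distrib_left power2_eq_square mult_ac)
  finally have cross: "(\<Sum>\<sigma>\<in>?R. \<Sum>v\<in>\<Lambda>. ?f (add_grain \<Lambda> v \<sigma>) * ?f \<sigma>) = ?n * (\<Sum>\<tau>\<in>?R. ?f \<tau> ^ 2)" .
  have "(\<Sum>\<sigma>\<in>?R. \<Sum>v\<in>\<Lambda>. ?f (add_grain \<Lambda> v \<sigma>) ^ 2) = (\<Sum>v\<in>\<Lambda>. \<Sum>\<sigma>\<in>?R. ?f (add_grain \<Lambda> v \<sigma>) ^ 2)"
    by (rule sum.swap)
  also have "\<dots> = (\<Sum>v\<in>\<Lambda>. \<Sum>\<tau>\<in>?R. ?f \<tau> ^ 2)"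
    by (intro sum.cong refl sum.reindex_bij_betw bij_betw_add_grain assms(1))
  finally have square: "(\<Sum>\<sigma>\<in>?R. \<Sum>v\<in>\<Lambda>. ?f (add_grain \<Lambda> v \<sigma>) ^ 2) = ?n * (\<Sum>\<tau>\<in>?R. ?f \<tau> ^ 2)"
    by simp
  have "(\<Sum>\<sigma>\<in>?R. \<Sum>v\<in>\<Lambda>. (?f (add_grain \<Lambda> v \<sigma>) - ?f \<sigma>) ^ 2) =
      (\<Sum>\<sigma>\<in>?R. \<Sum>v\<in>\<Lambda>. ?f (add_grain \<Lambda> v \<sigma>) ^ 2) + ?n * (\<Sum>\<sigma>\<in>?R. ?f \<sigma> ^ 2)
      - 2 * (\<Sum>\<sigma>\<in>?R. \<Sum>v\<in>\<Lambda>. ?f (add_grain \<Lambda> v \<sigma>) * ?f \<sigma>)"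
    by (simp add: power2_diff sum.distrib sum_subtractf sum_distrib_left mult.assoc)
  then have "(\<Sum>\<sigma>\<in>?R. \<Sum>v\<in>\<Lambda>. (?f (add_grain \<Lambda> v \<sigma>) - ?f \<sigma>) ^ 2) = 0"
    using cross square by simp
  then have "(\<Sum>v\<in>\<Lambda>. (?f (add_grain \<Lambda> v \<sigma>) - ?f \<sigma>) ^ 2) = 0" if "\<sigma> \<in> ?R" for \<sigma>
    using that R(1) by (subst (asm) sum_nonneg_eq_0_iff) (auto intro!: sum_nonneg)
  then have invariant: "?f (add_grain \<Lambda> v \<sigma>) = ?f \<sigma>" if "\<sigma> \<in> ?R" "v \<in> \<Lambda>" for v \<sigma>
    using that assms(1) by (subst (asm) sum_nonneg_eq_0_iff) auto
  have const: "?f \<sigma> = ?f (full_config \<Lambda>)" if "\<sigma> \<in> ?R" for \<sigma>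
  proof -
    have "full_config \<Lambda> \<in> {\<tau> \<in> ?R. ?f \<tau> = ?f \<sigma>}"
    proof (rule full_config_reached[OF assms(1)])
      show "{\<tau> \<in> ?R. ?f \<tau> = ?f \<sigma>} \<subseteq> stable_configs \<Lambda>" by (auto simp: recurrent_alt)
    qed (use that invariant add_grain_recurrent[OF assms(1)] in auto)
    then show ?thesis by simp
  qed
  have "1 = (\<Sum>\<sigma>\<in>?R. ?f \<sigma>)" using sum_pmf_eq_1[OF R(1) supp] by simp
  also have "\<dots> = real (card ?R) * ?f (full_config \<Lambda>)" using const by simp
  finally have c: "?f (full_config \<Lambda>) = 1 / real (card ?R)"
    using R by (simp add: field_simps)
  show ?thesis
  proof (rule pmf_eqI)
    fix \<sigma>
    show "?f \<sigma> = pmf (pmf_of_set ?R) \<sigma>"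
      using const[of \<sigma>] c supp R by (cases "\<sigma> \<in> ?R") (auto simp: set_pmf_eq indicator_def)
  qed
qed

lemma uniform_is_stationary:
  fixes \<Lambda> :: "(int ^ 'd) set"
  assumes "finite \<Lambda>" "\<Lambda> \<noteq> {}"
  shows "sandpile_stationary \<Lambda> (pmf_of_set (recurrent \<Lambda>))"
proof -
  let ?R = "recurrent \<Lambda>"
  have R: "finite ?R" "?R \<noteq> {}" using full_config_recurrent[OF assms(1)] assms(1) finite_burnable by auto
  have "bind_pmf (pmf_of_set ?R) (sandpile_kernel \<Lambda>) =
      bind_pmf (pmf_of_set \<Lambda>) (\<lambda>v. map_pmf (add_grain \<Lambda> v) (pmf_of_set ?R))"
    unfolding sandpile_kernel_def add_grain_def[symmetric] map_pmf_def by (rule bind_commute_pmf)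
  also have "\<dots> = bind_pmf (pmf_of_set \<Lambda>) (\<lambda>v. pmf_of_set ?R)"
    using assms R bij_betw_add_grain[OF assms(1)]
    by (intro bind_pmf_cong refl map_pmf_of_set_bij_betw) (auto simp: set_pmf_of_set)
  finally show ?thesis using R by (auto simp: sandpile_stationary_def recurrent_alt set_pmf_of_set)
qed

lemma sandpile_measure_uniform:
  fixes \<Lambda> :: "(int ^ 'd) set"
  assumes "finite \<Lambda>" "\<Lambda> \<noteq> {}"
  shows "sandpile_measure \<Lambda> = pmf_of_set (recurrent \<Lambda>)"
  unfolding sandpile_measure_def
proof (rule the_equality)
  show "sandpile_stationary \<Lambda> (pmf_of_set (recurrent \<Lambda>))"
    by (rule uniform_is_stationary[OF assms])
  show "\<pi> = pmf_of_set (recurrent \<Lambda>)" if "sandpile_stationary \<Lambda> \<pi>" for \<pi>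
    by (rule stationary_is_uniform[OF assms that])
qed

text \<open>
  For empty \<open>\<Lambda>\<close> there is no stationary measure, and \<^const>\<open>sandpile_measure\<close> is an unspecified
  distribution; but then the product is empty and both sides are \<open>1\<close>.
\<close>

lemma sandpile_expectation_height_one:
  fixes \<Lambda> V :: "(int ^ 'd) set"
  assumes "finite \<Lambda>" "V \<subseteq> \<Lambda>"
  shows "measure_pmf.expectation (sandpile_measure \<Lambda>) (\<lambda>\<rho>. \<Prod>v\<in>V. height_one v \<rho>) =
    real (card {\<rho> \<in> recurrent \<Lambda>. \<forall>v\<in>V. \<rho> v = 1}) / real (card (recurrent \<Lambda>))"
proof (cases "\<Lambda> = {}")
  case True
  then show ?thesis using assms by (simp add: burnable_empty)
next
  case False
  have fin: "finite V" "finite (recurrent \<Lambda>)" "recurrent \<Lambda> \<noteq> {}"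
    using assms full_config_recurrent[OF assms(1)] finite_burnable finite_subset by auto
  have "(\<Prod>v\<in>V. height_one v \<rho>) = (if \<forall>v\<in>V. \<rho> v = 1 then 1 else 0)" for \<rho>
    using fin(1) by (auto simp: height_one_def prod_zero_iff)
  then show ?thesis
    using fin assms(1) False
    by (simp add: sandpile_measure_uniform integral_pmf_of_set sum.If_cases Int_def)
qed

section \<open>Berezin integrals of quadratic actions\<close>

lemma left_deriv_twice: "left_deriv x (left_deriv x F) = 0"
proof -
  have "left_deriv x (left_deriv x F) + left_deriv x (left_deriv x F) = 0"
    using left_deriv_anticommute[of x x F] by (simp only: eq_neg_iff_add_eq_0)
  then have "2 *\<^sub>R left_deriv x (left_deriv x F) = 0" by (simp only: scaleR_2)
  then show ?thesis by simp
qed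

lemma berezin_empty: "berezin {} F = F"
  by (simp add: berezin_def)

lemma berezin_linear:
  assumes "finite A"
  shows "berezin A (F + G) = berezin A F + berezin A G"
    and "berezin A 0 = 0"
  using assms
  by (induction A rule: finite_induct) (simp_all add: berezin_empty berezin_insert left_deriv_linear)

lemma berezin_sum: "finite A \<Longrightarrow> berezin A (\<Sum>i\<in>I. f i) = (\<Sum>i\<in>I. berezin A (f i))"
  by (induction I rule: infinite_finite_induct) (auto simp: berezin_linear)

lemma berezin_left_deriv:
  assumes "finite A"
  shows "berezin A (left_deriv (Inr v) (left_deriv (Inl v) F)) =
    left_deriv (Inr v) (left_deriv (Inl v) (berezin A F))"
  using assms
proof (induction A rule: finite_induct)
  case (insert u A)
  let ?d = "\<lambda>v G. left_deriv (Inr v) (left_deriv (Inl v) G)"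
  have "?d u (?d v G) = ?d v (?d u G)" for G
    by (simp add: left_deriv_linear left_deriv_anticommute[of "Inl u" "Inr v"]
          left_deriv_anticommute[of "Inl u" "Inl v"] left_deriv_anticommute[of "Inr u" "Inr v"]
          left_deriv_anticommute[of "Inr u" "Inl v"])
  then show ?case using insert by (simp add: berezin_insert)
qed (simp add: berezin_empty)

lemma berezin_insert_inner:
  assumes "finite A" "v \<notin> A"
  shows "berezin (insert v A) F = berezin A (left_deriv (Inr v) (left_deriv (Inl v) F))"
  using assms by (simp add: berezin_insert berezin_left_deriv)

lemma berezin_total_derivative:
  assumes "finite A" "v \<in> A"
  shows "berezin A (left_deriv (Inl v) F) = 0"
proof -
  have "berezin (insert v (A - {v})) (left_deriv (Inl v) F) = 0"
    using assms by (subst berezin_insert_inner) (simp_all add: left_deriv_twice left_deriv_linear berezin_linear)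
  then show ?thesis using assms(2) by (simp add: insert_absorb)
qed

text \<open>
  A vanishing derivative expresses that the generator does not occur.
\<close>

definition free_of :: "(int ^ 'd) option \<Rightarrow> ('d::finite) fermions \<Rightarrow> bool" where
  "free_of v F \<longleftrightarrow> left_deriv (Inl v) F = 0 \<and> left_deriv (Inr v) F = 0"

lemma free_of_mult: "bosonic G \<Longrightarrow> free_of v G \<Longrightarrow> free_of v F \<Longrightarrow> free_of v (G * F)"
  by (simp add: free_of_def left_deriv_bosonic_mult)

lemma free_of_one: "free_of v 1"
  by (simp add: free_of_def left_deriv_one)

lemma free_of_gprod:
  "finite A \<Longrightarrow> (\<And>b. b \<in> A \<Longrightarrow> bosonic (f b)) \<Longrightarrow> (\<And>b. b \<in> A \<Longrightarrow> free_of v (f b)) \<Longrightarrow>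
    free_of v (gprod f A)"
  by (simp add: free_of_def left_deriv_gprod_eq_zero)

text \<open>
  The derivatives at \<open>v\<close> are taken first. They consume \<open>\<psi>\<^sub>v \<psi>bar\<^sub>v\<close>, with sign \<open>+\<close> because
  \<open>\<psi>\<^sub>v\<close> is removed from the front before \<open>\<psi>bar\<^sub>v\<close> gets there.
\<close>

lemma berezin_pinned_vertex:
  assumes "finite A" "v \<notin> A" "free_of v F"
  shows "berezin (insert v A) (\<psi> v * \<psi>bar v * F) = berezin A F"
  using assms
  by (simp add: berezin_insert_inner left_deriv_pair_mult left_deriv_ggen_mult free_of_def)

definition quadratic_action ::
  "((int ^ 'd) option \<Rightarrow> (int ^ 'd) option \<Rightarrow> real) \<Rightarrow> (int ^ 'd) option set \<Rightarrow> ('d::finite) fermions" where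
  "quadratic_action M S = (\<Sum>u\<in>S. \<Sum>v\<in>S. M u v *\<^sub>R (\<psi> u * \<psi>bar v))"

definition partition_function ::
  "((int ^ 'd) option \<Rightarrow> (int ^ 'd) option \<Rightarrow> real) \<Rightarrow> (int ^ ('d::finite)) option set \<Rightarrow> real" where
  "partition_function M S = gcoeff (berezin S (gexp (quadratic_action M S))) {}"

lemma action_cong:
  "(\<And>u v. u \<in> S \<Longrightarrow> v \<in> S \<Longrightarrow> M u v = M' u v) \<Longrightarrow> quadratic_action M S = quadratic_action M' S"
  unfolding quadratic_action_def by (intro sum.cong refl) simp

lemma gcoeff_pair_empty: "gcoeff (ggen a * ggen b) {} = 0"
  by (simp add: gcoeff_ggen_mult)

lemma bosonic_action: "bosonic (quadratic_action M S)"
  unfolding quadratic_action_def by (intro bosonic_intros)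

lemma gcoeff_action_empty: "gcoeff (quadratic_action M S) {} = 0"
  by (simp add: quadratic_action_def gcoeff_sum gcoeff_pair_empty)

lemma left_deriv_action:
  assumes "finite S"
  shows "left_deriv (Inl x) (quadratic_action M S) = (if x \<in> S then \<Sum>v\<in>S. M x v *\<^sub>R \<psi>bar v else 0)"
    and "x \<notin> S \<Longrightarrow> left_deriv (Inr x) (quadratic_action M S) = 0"
proof -
  have "left_deriv (Inl x) (quadratic_action M S) = (\<Sum>u\<in>S. if u = x then \<Sum>v\<in>S. M x v *\<^sub>R \<psi>bar v else 0)"
    unfolding quadratic_action_def left_deriv_sum
    by (intro sum.cong refl) (simp add: left_deriv_linear left_deriv_pair)
  then show "left_deriv (Inl x) (quadratic_action M S) = (if x \<in> S then \<Sum>v\<in>S. M x v *\<^sub>R \<psi>bar v else 0)"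
    using assms by simp
  show "left_deriv (Inr x) (quadratic_action M S) = 0" if "x \<notin> S"
    unfolding quadratic_action_def left_deriv_sum
    by (intro sum.neutral ballI) (use that in \<open>auto simp: left_deriv_linear left_deriv_pair\<close>)
qed

lemma free_of_gexp_action:
  assumes "finite S" "v \<notin> S"
  shows "free_of v (gexp (quadratic_action M S))"
  using assms by (simp add: free_of_def left_deriv_gexp bosonic_action gcoeff_action_empty left_deriv_action)

lemma pair_mult_ggen:
  "ggen a * ggen b * (ggen a * F) = 0" "ggen a * ggen b * (ggen c * ggen b) = 0"
proof -
  have sq: "ggen a * (ggen a * G) = 0" for a :: 'a and G
    using ggen_square[of a] by (metis mult.assoc mult_zero_left)
  show "ggen a * ggen b * (ggen a * F) = 0"
    by (simp add: mult.assoc ggen_mult_left_anticommute[of b a] sq)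
  show "ggen a * ggen b * (ggen c * ggen b) = 0"
    by (simp add: mult.assoc ggen_mult_left_anticommute[of b c] ggen_square)
qed

text \<open>
  Each term of the action that involves the vertex \<open>v\<close> contains \<open>\<psi>\<^sub>v\<close> or \<open>\<psi>bar\<^sub>v\<close> and is killed by
  the prefactor.
\<close>

lemma pinned_action:
  assumes "finite S" "v \<notin> S"
  shows "\<psi> v * \<psi>bar v * gexp (quadratic_action M (insert v S)) = \<psi> v * \<psi>bar v * gexp (quadratic_action M S)"
proof -
  let ?T = "(\<Sum>w\<in>insert v S. M v w *\<^sub>R (\<psi> v * \<psi>bar w)) + (\<Sum>u\<in>S. M u v *\<^sub>R (\<psi> u * \<psi>bar v))"
  have "quadratic_action M (insert v S) = ?T + quadratic_action M S"
    using assms by (simp add: quadratic_action_def sum.distrib add.assoc)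
  moreover have "\<psi> v * \<psi>bar v * ?T = 0"
    by (simp add: distrib_left sum_distrib_left pair_mult_ggen del: sum.insert sum.insert_if)
  moreover have "bosonic ?T" by (intro bosonic_intros)
  moreover have "gcoeff ?T {} = 0"
    by (simp add: gcoeff_sum gcoeff_pair_empty del: sum.insert sum.insert_if)
  ultimately show ?thesis
    by (simp only: mult_gexp_add_annihilated gcoeff_action_empty)
qed

definition add_mass ::
  "'a \<Rightarrow> ('a \<Rightarrow> 'a \<Rightarrow> real) \<Rightarrow> 'a \<Rightarrow> 'a \<Rightarrow> real" where
  "add_mass v M a b = M a b + (if a = v \<and> b = v then 1 else 0)"

lemma action_add_mass:
  assumes "finite S" "v \<in> S"
  shows "quadratic_action (add_mass v M) S = \<psi> v * \<psi>bar v + quadratic_action M S"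
proof -
  have "quadratic_action (add_mass v M) S = quadratic_action M S +
      (\<Sum>a\<in>S. \<Sum>b\<in>S. if a = v then (if b = v then \<psi> a * \<psi>bar b else 0) else 0)"
    unfolding quadratic_action_def sum.distrib[symmetric] add_mass_def
    by (intro sum.cong refl) (auto simp: scaleR_add_left)
  also have "(\<Sum>a\<in>S. \<Sum>b\<in>S. if a = v then (if b = v then \<psi> a * \<psi>bar b else 0) else 0) =
      (\<Sum>a\<in>S. if a = v then \<psi> v * \<psi>bar v else 0)"
    using assms by (intro sum.cong refl) simp
  also have "\<dots> = \<psi> v * \<psi>bar v" using assms by simp
  finally show ?thesis by (simp add: add.commute)
qed

text \<open>
  The factor \<open>exp (\<psi>\<^sub>v \<psi>bar\<^sub>v) = 1 + \<psi>\<^sub>v \<psi>bar\<^sub>v\<close> splits the integral into the old one and one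
  in which \<open>v\<close> is pinned, hence deleted.
\<close>

lemma partition_function_add_mass:
  assumes "finite S" "v \<in> S"
  shows "partition_function (add_mass v M) S = partition_function M S + partition_function M (S - {v})"
proof -
  let ?p = "\<psi> v * \<psi>bar v"
  have S: "insert v (S - {v}) = S" using assms(2) by auto
  have "gexp (quadratic_action (add_mass v M) S) = (1 + ?p) * gexp (quadratic_action M S)"
    unfolding action_add_mass[OF assms]
    by (intro gexp_add_square_zero bosonic_pair pair_mult_ggen gcoeff_pair_empty gcoeff_action_empty)
  also have "\<dots> = gexp (quadratic_action M S) + ?p * gexp (quadratic_action M (S - {v}))"
    using pinned_action[of "S - {v}" v M, unfolded S] assms(1) by (simp add: distrib_right)
  finally show ?thesis
    using assms(1) berezin_pinned_vertex[of "S - {v}" v "gexp (quadratic_action M (S - {v}))", unfolded S]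
      free_of_gexp_action[of "S - {v}" v M]
    by (simp add: partition_function_def berezin_linear)
qed

text \<open>
  If the columns of \<open>M\<close> sum to zero, the operator \<open>\<partial> = \<Sum>\<^sub>v \<partial>\<^sub>\<psi>\<^sub>v\<close> annihilates \<open>G = exp\<close> of the
  action. Since \<open>\<partial> \<psi>\<^sub>x = 1\<close>, it follows that \<open>G = \<partial> (\<psi>\<^sub>x G)\<close>, and the integral of a derivative
  is zero.
\<close>

lemma partition_function_no_sink:
  assumes "finite S" "x \<in> S" and zero: "\<And>w. w \<in> S \<Longrightarrow> (\<Sum>u\<in>S. M u w) = 0"
  shows "partition_function M S = 0"
proof -
  let ?G = "gexp (quadratic_action M S)"
  have "(\<Sum>v\<in>S. left_deriv (Inl v) ?G) = (\<Sum>v\<in>S. \<Sum>w\<in>S. M v w *\<^sub>R \<psi>bar w) * ?G"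
    using assms(1)
    by (simp add: left_deriv_gexp bosonic_action gcoeff_action_empty left_deriv_action sum_distrib_right)
  also have "(\<Sum>v\<in>S. \<Sum>w\<in>S. M v w *\<^sub>R \<psi>bar w) = (\<Sum>w\<in>S. (\<Sum>v\<in>S. M v w) *\<^sub>R \<psi>bar w)"
    by (subst sum.swap) (simp add: scaleR_sum_left)
  also have "\<dots> = 0" using zero by simp
  finally have D: "(\<Sum>v\<in>S. left_deriv (Inl v) ?G) = 0" by simp
  have "(\<Sum>v\<in>S. left_deriv (Inl v) (\<psi> x * ?G)) =
      (\<Sum>v\<in>S. if v = x then ?G else 0) - \<psi> x * (\<Sum>v\<in>S. left_deriv (Inl v) ?G)"
    by (simp add: left_deriv_ggen_mult sum_subtractf sum_distrib_left)
  then have "?G = (\<Sum>v\<in>S. left_deriv (Inl v) (\<psi> x * ?G))"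
    using assms(1,2) D by simp
  then have "berezin S ?G = (\<Sum>v\<in>S. berezin S (left_deriv (Inl v) (\<psi> x * ?G)))"
    using berezin_sum[OF assms(1)] by metis
  also have "\<dots> = 0" using assms(1) by (simp add: berezin_total_derivative)
  finally show ?thesis by (simp add: partition_function_def)
qed

section \<open>Burnable configurations and the partition function\<close>

definition mass_minus_adjacency ::
  "(int ^ 'd \<Rightarrow> nat) \<Rightarrow> (int ^ 'd) option \<Rightarrow> (int ^ 'd) option \<Rightarrow> real" where
  "mass_minus_adjacency D a b = (case (a, b) of
    (Some u, Some v) \<Rightarrow> if u = v then real (D u) else if u \<sim> v then - 1 else 0
  | _ \<Rightarrow> 0)"

lemma mass_minus_adjacency_Some:
  "mass_minus_adjacency D (Some u) (Some v) = (if u = v then real (D u) else if u \<sim> v then - 1 else 0)"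
  by (simp add: mass_minus_adjacency_def)

lemma sum_mass_minus_adjacency:
  assumes "finite S" "w \<in> S"
  shows "(\<Sum>a\<in>Some ` S. mass_minus_adjacency D a (Some w)) = real (D w) - real (nbr_count S w)"
proof -
  have "(\<Sum>a\<in>Some ` S. mass_minus_adjacency D a (Some w)) =
      (\<Sum>u\<in>S. (if u = w then real (D u) else 0) - (if w \<sim> u then 1 else 0))"
    by (subst sum.reindex)
      (auto intro!: sum.cong simp: mass_minus_adjacency_Some neighbours_sym[of w] not_neighbours_refl)
  also have "\<dots> = real (D w) - real (nbr_count S w)"
    using assms by (simp add: sum_subtractf sum.If_cases nbr_count_def Int_def)
  finally show ?thesis .
qed

text \<open>
  Both sides satisfy the same recursion when a capacity is lowered by one, which is possible until
  \<open>D\<close> is the degree in \<open>S\<close>. There both sides vanish unless \<open>S\<close> is empty.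
\<close>

lemma card_burnable_eq_partition_function:
  fixes S :: "(int ^ 'd) set"
  assumes "finite S" "\<And>v. v \<in> S \<Longrightarrow> nbr_count S v \<le> D v"
  shows "real (card (burnable S D)) = partition_function (mass_minus_adjacency D) (Some ` S)"
  using assms
proof (induction "card S" arbitrary: S D rule: less_induct)
  (* The recursion leads to S - {v} or to a smaller total capacity. The capacities are not compared
     when S shrinks, so the induction on S is the outer one. *)
  case (less S)
  note smaller = less.hyps and finS = less.prems(1)
  show ?case using less.prems(2)
  proof (induction "\<Sum>v\<in>S. D v" arbitrary: D rule: less_induct)
    case (less D)
    show ?case
    proof (cases "\<exists>v\<in>S. nbr_count S v < D v")
      case True
      then obtain v where v: "v \<in> S" "nbr_count S v < D v" by blast
      define E where "E = D(v := D v - 1)"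
      have D: "D = E(v := Suc (E v))" using v(2) by (auto simp: E_def)
      have E: "nbr_count S u \<le> E u" if "u \<in> S" for u
        using less.prems[OF that] v by (auto simp: E_def)
      have "(\<Sum>u\<in>S. E u) < (\<Sum>u\<in>S. D u)"
        using v finS by (intro sum_strict_mono_ex1) (auto simp: E_def intro!: bexI[of _ v])
      from less.hyps[OF this E]
      have "real (card (burnable S E)) = partition_function (mass_minus_adjacency E) (Some ` S)" .
      moreover have "real (card (burnable (S - {v}) E)) =
          partition_function (mass_minus_adjacency E) (Some ` (S - {v}))"
      proof (rule smaller)
        show "card (S - {v}) < card S" using finS v(1) by (rule card_Diff1_less)
        show "nbr_count (S - {v}) u \<le> E u" if "u \<in> S - {v}" for u
          using E[of u] nbr_count_mono[of "S - {v}" S u] that by auto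
      qed (use finS in auto)
      moreover have "card (burnable S D) = card (burnable S E) + card (burnable (S - {v}) E)"
        unfolding D using finS v(1) E by (intro card_burnable_upd)
      moreover have "mass_minus_adjacency D = add_mass (Some v) (mass_minus_adjacency E)"
        by (auto simp: fun_eq_iff D add_mass_def mass_minus_adjacency_def split: option.splits)
      moreover have "Some ` S - {Some v} = Some ` (S - {v})" by auto
      ultimately show ?thesis
        using finS v(1) by (simp add: partition_function_add_mass)
    next
      case False
      then have eq: "D v = nbr_count S v" if "v \<in> S" for v
        using less.prems[OF that] that by force
      show ?thesis
      proof (cases "S = {}")
        case True
        then show ?thesis
          by (simp add: burnable_empty partition_function_def berezin_empty quadratic_action_def gexp_zero
              one_grassmann_def gcoeff_gmonom)
      next
        case False
        then obtain x where "x \<in> S" by blast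
        then have "partition_function (mass_minus_adjacency D) (Some ` S) = 0"
          using finS eq by (intro partition_function_no_sink[of _ "Some x"]) (auto simp: sum_mass_minus_adjacency)
        then show ?thesis using burnable_no_sink[OF False, of D] eq by simp
      qed
    qed
  qed
qed

section \<open>The pinned state of the height-one observables\<close>

text \<open>
  The factor \<open>\<psi>\<^sub>g \<psi>bar\<^sub>g\<close> removes all terms of the exponent that involve the ghost. What is left is the action with the
  Dirichlet Laplacian on \<open>\<Lambda>\<close>, and then the ghost itself is integrated out.
\<close>

lemma pinned_unnormalized_free_of_ghost:
  fixes \<Lambda> :: "(int ^ 'd) set"
  assumes "finite \<Lambda>" "free_of None F"
  shows "pinned_unnormalized \<Lambda> F =
    gcoeff (berezin (Some ` \<Lambda>)
      (gexp (quadratic_action (mass_minus_adjacency (\<lambda>_. 2 * CARD('d))) (Some ` \<Lambda>)) * F)) {}"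
proof -
  let ?M = "\<lambda>u v. - wired_laplacian \<Lambda> u v" and ?p = "\<psi> None * \<psi>bar None :: 'd fermions"
  let ?A = "quadratic_action (mass_minus_adjacency (\<lambda>_. 2 * CARD('d))) (Some ` \<Lambda>)"
  have "gff_action \<Lambda> + ?p = quadratic_action (add_mass None ?M) (insert None (Some ` \<Lambda>))"
    using assms(1) by (subst action_add_mass) (auto simp: gff_action_def quadratic_action_def wired_def add.commute)
  then have "?p * gexp (gff_action \<Lambda> + ?p) = ?p * gexp (quadratic_action (add_mass None ?M) (Some ` \<Lambda>))"
    using assms(1) by (simp only:) (rule pinned_action; auto)
  also have "quadratic_action (add_mass None ?M) (Some ` \<Lambda>) = ?A"
    by (rule action_cong) (auto simp: add_mass_def laplacian_def mass_minus_adjacency_Some)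
  finally have "?p * gexp (gff_action \<Lambda> + ?p) * F = ?p * (gexp ?A * F)"
    by (simp add: mult.assoc)
  moreover have "free_of None (gexp ?A * F)"
    using assms by (intro free_of_mult bosonic_gexp bosonic_action free_of_gexp_action) auto
  then have "berezin (insert None (Some ` \<Lambda>)) (?p * (gexp ?A * F)) = berezin (Some ` \<Lambda>) (gexp ?A * F)"
    using assms(1) by (intro berezin_pinned_vertex) auto
  ultimately show ?thesis by (simp add: pinned_unnormalized_def wired_def)
qed

abbreviation bond :: "int ^ 'd \<Rightarrow> int ^ 'd \<Rightarrow> ('d::finite) fermions" where
  "bond v e \<equiv> grad_psi e v * grad_psibar e v"

lemma bond_expand:
  "bond v e = \<psi> (Some (v + e)) * \<psi>bar (Some (v + e)) - \<psi> (Some (v + e)) * \<psi>bar (Some v)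
    - \<psi> (Some v) * \<psi>bar (Some (v + e)) + \<psi> (Some v) * \<psi>bar (Some v)"
  by (simp add: grad_psi_def grad_psibar_def left_diff_distrib right_diff_distrib)

lemma bosonic_bond: "bosonic (bond v e)"
  unfolding bond_expand by (intro bosonic_intros)

lemma gcoeff_bond_empty: "gcoeff (bond v e) {} = 0"
  unfolding bond_expand by (simp add: gcoeff_pair_empty)

lemma bond_square: "bond v e * bond v e = 0"
proof -
  have "grad_psi e v * grad_psi e v + grad_psi e v * grad_psi e v = 0"
    using grad_anticommute(1)[of e v e v] by (simp only: eq_neg_iff_add_eq_0)
  then have "2 *\<^sub>R (grad_psi e v * grad_psi e v) = 0" by (simp only: scaleR_2)
  then have sq: "grad_psi e v * grad_psi e v = 0" by simp
  have "bond v e * bond v e = grad_psi e v * (grad_psibar e v * grad_psi e v) * grad_psibar e v"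
    by (simp add: mult.assoc)
  also have "grad_psibar e v * grad_psi e v = - (grad_psi e v * grad_psibar e v)"
    using grad_anticommute(2)[of e v e v] by simp
  also have "grad_psi e v * - (grad_psi e v * grad_psibar e v) * grad_psibar e v =
      - (grad_psi e v * grad_psi e v * grad_psibar e v * grad_psibar e v)"
    by (simp add: mult.assoc)
  finally show ?thesis by (simp add: sq)
qed

lemma bosonic_fermion_X: "bosonic (fermion_X v)"
  unfolding fermion_X_def by (intro bosonic_scaleR bosonic_sum bosonic_bond)

lemma bosonic_fermion_Y: "bosonic (fermion_Y v)"
  unfolding fermion_Y_def by (intro bosonic_gprod bosonic_diff bosonic_one bosonic_bond card_unit_steps)

lemma bosonic_left_commute: "bosonic q \<Longrightarrow> F * (q * G) = q * (F * G)"
  using bosonic_commute[of q F] by (simp add: mult.assoc[symmetric])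

text \<open>
  For \<open>p\<close> of square zero, \<open>1 - p = exp (- p)\<close>.
\<close>

lemma gexp_cancel:
  assumes "finite I" "gcoeff B {} = 0"
    and p: "\<And>i. i \<in> I \<Longrightarrow> bosonic (p i)" "\<And>i. i \<in> I \<Longrightarrow> p i * p i = 0" "\<And>i. i \<in> I \<Longrightarrow> gcoeff (p i) {} = 0"
  shows "gexp (B + (\<Sum>i\<in>I. p i)) * gprod (\<lambda>i. 1 - p i) I = gexp B"
  using assms(1) p
proof (induction I rule: finite_induct)
  case empty
  then show ?case by (simp add: gprod_empty)
next
  case (insert a I)
  let ?E = "gexp (B + (\<Sum>i\<in>I. p i))" and ?P = "gprod (\<lambda>i. 1 - p i) I"
  have bos: "bosonic (1 - p a)" using insert.prems by (intro bosonic_diff bosonic_one) auto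
  have "gexp (p a + (B + (\<Sum>i\<in>I. p i))) = (1 + p a) * ?E"
    using insert.prems assms(2) by (intro gexp_add_square_zero) (auto simp: gcoeff_sum)
  moreover have "p a + (B + (\<Sum>i\<in>I. p i)) = B + (\<Sum>i\<in>insert a I. p i)"
    using insert.hyps by (simp add: add_ac)
  ultimately have "gexp (B + (\<Sum>i\<in>insert a I. p i)) = (1 + p a) * ?E" by simp
  moreover have "gprod (\<lambda>i. 1 - p i) (insert a I) = (1 - p a) * ?P"
    using insert.hyps insert.prems by (intro gprod_bosonic_insert bosonic_diff bosonic_one) auto
  moreover have "(1 + p a) * ?E * ((1 - p a) * ?P) = (1 + p a) * (1 - p a) * (?E * ?P)"
    by (simp only: mult.assoc bosonic_left_commute[OF bos, of ?E])
  moreover have "(1 + p a) * (1 - p a) = 1"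
    using insert.prems(2)[of a] by (simp add: distrib_right right_diff_distrib)
  ultimately show ?case using insert by simp
qed

text \<open>
  \<open>Y\<^sub>v\<close> cancels the bonds at \<open>v\<close>, one factor for each.
\<close>

lemma gexp_bonds_XY:
  assumes "finite V" "gcoeff B {} = 0"
  shows "gexp (B + (\<Sum>v\<in>V. \<Sum>e\<in>unit_steps. bond v e)) * gprod (\<lambda>v. fermion_X v * fermion_Y v) V =
    gexp B * gprod fermion_X V"
  using assms(1)
proof (induction V rule: finite_induct)
  case empty
  then show ?case by (simp add: gprod_empty)
next
  case (insert v V)
  let ?B = "B + (\<Sum>v\<in>V. \<Sum>e\<in>unit_steps. bond v e)" and ?E = "\<Sum>e\<in>unit_steps. bond v e"
  let ?P = "gprod (\<lambda>v. fermion_X v * fermion_Y v) V"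
  have "gexp (?B + ?E) * fermion_Y v = gexp ?B"
    unfolding fermion_Y_def
    by (rule gexp_cancel)
      (simp_all add: card_unit_steps gcoeff_sum gcoeff_bond_empty assms(2) bosonic_bond bond_square)
  moreover have "B + (\<Sum>v\<in>insert v V. \<Sum>e\<in>unit_steps. bond v e) = ?B + ?E"
    using insert.hyps by (simp add: add_ac)
  moreover have "gprod (\<lambda>v. fermion_X v * fermion_Y v) (insert v V) = fermion_X v * fermion_Y v * ?P"
    using insert.hyps by (intro gprod_bosonic_insert bosonic_mult bosonic_fermion_X bosonic_fermion_Y)
  moreover have "gprod fermion_X (insert v V) = fermion_X v * gprod fermion_X V"
    using insert.hyps by (intro gprod_bosonic_insert bosonic_fermion_X)
  moreover have "F * (fermion_X v * fermion_Y v * ?P) = fermion_X v * (F * fermion_Y v * ?P)" for F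
    by (simp only: mult.assoc bosonic_left_commute[OF bosonic_fermion_X, of F])
  moreover have "F * (fermion_X v * G) = fermion_X v * (F * G)" for F G
    by (rule bosonic_left_commute[OF bosonic_fermion_X])
  ultimately show ?case using insert.IH by (simp only:)
qed

lemma free_of_fermion_X:
  assumes "x \<noteq> Some v" "\<And>e. e \<in> unit_steps \<Longrightarrow> x \<noteq> Some (v + e)"
  shows "free_of x (fermion_X v)"
proof -
  have "left_deriv (Inl x) (bond v e) = 0 \<and> left_deriv (Inr x) (bond v e) = 0" if "e \<in> unit_steps" for e
    using assms(1) assms(2)[OF that] unfolding bond_expand
    by (simp add: left_deriv_linear left_deriv_pair)
  then show ?thesis by (simp add: free_of_def fermion_X_def left_deriv_linear left_deriv_sum)
qed

lemma free_of_fermion_Y: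
  assumes "x \<noteq> Some v" "\<And>e. e \<in> unit_steps \<Longrightarrow> x \<noteq> Some (v + e)"
  shows "free_of x (fermion_Y v)"
proof -
  have "left_deriv (Inl x) (bond v e) = 0 \<and> left_deriv (Inr x) (bond v e) = 0" if "e \<in> unit_steps" for e
    using assms(1) assms(2)[OF that] unfolding bond_expand
    by (simp add: left_deriv_linear left_deriv_pair)
  then show ?thesis unfolding fermion_Y_def
    by (intro free_of_gprod)
      (simp_all add: card_unit_steps bosonic_diff bosonic_one bosonic_bond free_of_def left_deriv_linear left_deriv_one)
qed

lemma unit_step_neq_self: "e \<in> unit_steps \<Longrightarrow> v \<noteq> v + e"
  using zero_notin_unit_steps by auto

text \<open>
  Differentiating \<open>(\<psi>\<^sub>v\<^sub>+\<^sub>e - \<psi>\<^sub>v) (\<psi>bar\<^sub>v\<^sub>+\<^sub>e - \<psi>bar\<^sub>v)\<close> by \<open>\<psi>\<^sub>v\<close> and then by \<open>\<psi>bar\<^sub>v\<close> gives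
  \<open>1\<close> for each of the \<open>2d\<close> directions, and \<open>X\<^sub>v\<close> is their average.
\<close>

lemma left_derivs_fermion_X_mult:
  assumes "free_of (Some v) H"
  shows "left_deriv (Inr (Some v)) (left_deriv (Inl (Some v)) (fermion_X v * H)) = H"
proof -
  have bond: "left_deriv (Inr (Some v)) (left_deriv (Inl (Some v)) (bond v e * H)) = H"
    if "e \<in> unit_steps" for e
  proof -
    have "v + e \<noteq> v" using unit_step_neq_self[OF that, of v] by simp
    then show ?thesis
      using assms unfolding bond_expand
      by (simp add: distrib_right left_diff_distrib left_deriv_linear left_deriv_pair_mult
          left_deriv_ggen_mult free_of_def)
  qed
  have "left_deriv (Inr (Some v)) (left_deriv (Inl (Some v)) (fermion_X v * H)) =
      (1 / (2 * real CARD('a))) *\<^sub>R (\<Sum>e\<in>unit_steps.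
        left_deriv (Inr (Some v)) (left_deriv (Inl (Some v)) (bond v e * H)))"
    by (simp add: fermion_X_def sum_distrib_right left_deriv_sum left_deriv_linear)
  also have "(\<Sum>e\<in>unit_steps. left_deriv (Inr (Some v)) (left_deriv (Inl (Some v)) (bond v e * H))) =
      (2 * real CARD('a)) *\<^sub>R H"
    using bond by (simp add: card_unit_steps sum_constant_scaleR del: sum_constant)
  finally show ?thesis by simp
qed

text \<open>
  As no two sites of \<open>W\<close> are neighbours, the fields at \<open>v \<in> W\<close> occur only in \<open>X\<^sub>v\<close>, and the sites
  of \<open>W\<close> can be integrated out one after the other.
\<close>

lemma berezin_fermion_X:
  fixes A W :: "(int ^ 'd) set"
  assumes "finite A" "finite W" "A \<inter> W = {}"
    and "\<And>u v. u \<in> W \<Longrightarrow> v \<in> W \<Longrightarrow> \<not> u \<sim> v"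
    and "\<And>v. v \<in> W \<Longrightarrow> free_of (Some v) G" and "bosonic G"
  shows "berezin (Some ` (A \<union> W)) (G * gprod fermion_X W) = berezin (Some ` A) G"
  using assms(2,3,4,5)
proof (induction W rule: finite_induct)
  case empty
  then show ?case by (simp add: gprod_empty)
next
  case (insert v W)
  let ?P = "gprod fermion_X W"
  have "free_of (Some v) (fermion_X w)" if "w \<in> W" for w
  proof (rule free_of_fermion_X)
    show "Some v \<noteq> Some w" using that insert.hyps by auto
    show "Some v \<noteq> Some (w + e)" if "e \<in> unit_steps" for e
      using insert.prems(2)[of w v] \<open>w \<in> W\<close> that by (auto simp: neighbours_def)
  qed
  then have free: "free_of (Some v) (G * ?P)"
    using insert by (intro free_of_mult free_of_gprod assms(6) bosonic_fermion_X) auto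
  have "gprod fermion_X (insert v W) = fermion_X v * ?P"
    using insert.hyps by (intro gprod_bosonic_insert bosonic_fermion_X)
  then have "G * gprod fermion_X (insert v W) = fermion_X v * (G * ?P)"
    using bosonic_commute[OF bosonic_fermion_X, of v G] by (simp add: mult.assoc[symmetric])
  moreover have "Some ` (A \<union> insert v W) = insert (Some v) (Some ` (A \<union> W))" by auto
  moreover have "Some v \<notin> Some ` (A \<union> W)" using insert by auto
  ultimately have "berezin (Some ` (A \<union> insert v W)) (G * gprod fermion_X (insert v W)) =
      berezin (Some ` (A \<union> W)) (G * ?P)"
    using assms(1) insert.hyps(1) left_derivs_fermion_X_mult[OF free]
    by (simp add: berezin_insert_inner)
  then show ?case using insert by simp
qed

lemma action_sums:
  fixes S :: "(int ^ 'd) set"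
  assumes "finite S"
  shows "quadratic_action (mass_minus_adjacency D) (Some ` S) =
    (\<Sum>u\<in>S. real (D u) *\<^sub>R (\<psi> (Some u) * \<psi>bar (Some u)))
    - (\<Sum>u\<in>S. \<Sum>w\<in>S. if u \<sim> w then \<psi> (Some u) * \<psi>bar (Some w) else 0)"
proof -
  have "quadratic_action (mass_minus_adjacency D) (Some ` S) =
      (\<Sum>u\<in>S. \<Sum>w\<in>S. (if w = u then real (D u) *\<^sub>R (\<psi> (Some u) * \<psi>bar (Some w)) else 0)
        - (if u \<sim> w then \<psi> (Some u) * \<psi>bar (Some w) else 0))"
    unfolding quadratic_action_def
    by (simp add: sum.reindex, intro sum.cong refl)
      (auto simp: mass_minus_adjacency_Some not_neighbours_refl)
  then show ?thesis using assms by (simp add: sum_subtractf)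
qed

text \<open>
  A bond at \<open>v\<close> contributes, besides the off-diagonal terms of its edge, one unit of diagonal mass at
  each endpoint. Sites of \<open>V\<close> are interior and independent, so both endpoints are in \<open>\<Lambda>\<close> and each
  edge at \<open>V\<close> is counted once. The masses at the outer endpoints are missing from the remaining
  diagonal.
\<close>

lemma action_split_bonds:
  fixes \<Lambda> V :: "(int ^ 'd) set"
  assumes "finite \<Lambda>" "V \<subseteq> lattice_interior \<Lambda>"
    and indep: "\<And>u v. u \<in> V \<Longrightarrow> v \<in> V \<Longrightarrow> \<not> u \<sim> v"
  shows "quadratic_action (mass_minus_adjacency (\<lambda>_. 2 * CARD('d))) (Some ` \<Lambda>) =
    quadratic_action (mass_minus_adjacency (\<lambda>u. 2 * CARD('d) - nbr_count V u)) (Some ` (\<Lambda> - V))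
    + (\<Sum>v\<in>V. \<Sum>e\<in>unit_steps. bond v e)"
proof -
  define S where "S = \<Lambda> - V"
  have V: "V \<subseteq> \<Lambda>" using assms(2) by (auto simp: lattice_interior_def)
  have fin: "finite S" "finite V" using assms(1) V by (auto simp: S_def intro: finite_subset)
  have \<Lambda>: "\<Lambda> = S \<union> V" "S \<inter> V = {}" using V by (auto simp: S_def)
  let ?c = "\<lambda>u w. \<psi> (Some u) * \<psi>bar (Some w) :: 'd fermions"
  let ?n = "\<lambda>u w F. if u \<sim> w then F else 0 :: 'd fermions"
  let ?K = "2 * real CARD('d)"
  have nbrs: "{w. v \<sim> w} = {w \<in> S. v \<sim> w}" if "v \<in> V" for v
    using that assms(2) indep[OF that] by (auto simp: S_def lattice_interior_def inner_boundary_def)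
  have bonds: "(\<Sum>e\<in>unit_steps. bond v e) =
      ?K *\<^sub>R ?c v v + (\<Sum>w\<in>S. ?n v w (?c w w)) - (\<Sum>w\<in>S. ?n v w (?c w v)) - (\<Sum>w\<in>S. ?n v w (?c v w))"
    if v: "v \<in> V" for v
  proof -
    have "(\<Sum>e\<in>unit_steps. bond v e) = (\<Sum>w | v \<sim> w. ?c w w - ?c w v - ?c v w + ?c v v)"
      unfolding sum_neighbours by (intro sum.cong refl) (simp add: bond_expand)
    also have "\<dots> = (\<Sum>w | v \<sim> w. ?c w w) - (\<Sum>w | v \<sim> w. ?c w v) - (\<Sum>w | v \<sim> w. ?c v w) + ?K *\<^sub>R ?c v v"
      by (simp add: sum.distrib sum_subtractf sum_constant_scaleR card_neighbours del: sum_constant)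
    finally show ?thesis
      unfolding nbrs[OF v] using fin(1) by (simp add: sum.inter_filter)
  qed
  have count: "(\<Sum>v\<in>V. \<Sum>w\<in>S. ?n v w (?c w w)) = (\<Sum>w\<in>S. real (nbr_count V w) *\<^sub>R ?c w w)"
  proof -
    have "(\<Sum>v\<in>V. ?n v w (?c w w)) = real (nbr_count V w) *\<^sub>R ?c w w" for w
      using fin(2) neighbours_sym[of w]
      by (simp add: sum.inter_filter[symmetric] sum_constant_scaleR nbr_count_def del: sum_constant)
    then show ?thesis by (subst sum.swap) simp
  qed
  have adj: "(\<Sum>u\<in>\<Lambda>. \<Sum>w\<in>\<Lambda>. ?n u w (?c u w)) = (\<Sum>u\<in>S. \<Sum>w\<in>S. ?n u w (?c u w))
      + (\<Sum>v\<in>V. \<Sum>w\<in>S. ?n v w (?c w v)) + (\<Sum>v\<in>V. \<Sum>w\<in>S. ?n v w (?c v w))"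
  proof -
    have "(\<Sum>u\<in>V. \<Sum>w\<in>V. ?n u w (?c u w)) = 0" using indep by (simp add: sum.neutral)
    moreover have "(\<Sum>u\<in>S. \<Sum>w\<in>V. ?n u w (?c u w)) = (\<Sum>v\<in>V. \<Sum>w\<in>S. ?n v w (?c w v))"
      by (subst sum.swap) (simp add: neighbours_sym)
    ultimately show ?thesis
      unfolding \<Lambda>(1) using fin \<Lambda>(2) by (simp add: sum.union_disjoint sum.distrib add_ac)
  qed
  have diag: "(\<Sum>u\<in>S. real (2 * CARD('d) - nbr_count V u) *\<^sub>R ?c u u) =
      (\<Sum>u\<in>S. ?K *\<^sub>R ?c u u) - (\<Sum>u\<in>S. real (nbr_count V u) *\<^sub>R ?c u u)"
    unfolding sum_subtractf[symmetric] using nbr_count_le[of V]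
    by (intro sum.cong refl) (simp add: of_nat_diff scaleR_diff_left)
  have "(\<Sum>u\<in>\<Lambda>. ?K *\<^sub>R ?c u u) = (\<Sum>u\<in>S. ?K *\<^sub>R ?c u u) + (\<Sum>u\<in>V. ?K *\<^sub>R ?c u u)"
    unfolding \<Lambda>(1) using fin \<Lambda>(2) by (rule sum.union_disjoint)
  then show ?thesis
    unfolding S_def[symmetric] action_sums[OF assms(1)] action_sums[OF fin(1)] diag adj
    using count bonds by (simp add: sum.distrib sum_subtractf)
qed

theorem theorem3p1:
  fixes \<Lambda> V :: "(int ^ 'd) set"
  assumes "CARD('d) \<ge> 2"
    and "finite \<Lambda>"
    and "lattice_connected \<Lambda>"
    and "V \<subseteq> lattice_interior \<Lambda>"
    and "good_set \<Lambda> V"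
  shows "measure_pmf.expectation (sandpile_measure \<Lambda>) (\<lambda>\<rho>. \<Prod>v\<in>V. height_one v \<rho>) =
    pinned_state \<Lambda> (gprod (\<lambda>v. fermion_X v * fermion_Y v) V)"
proof -
  let ?D = "\<lambda>_. 2 * CARD('d)" and ?E = "\<lambda>u. 2 * CARD('d) - nbr_count V u"
  let ?XY = "gprod (\<lambda>v. fermion_X v * fermion_Y v) V" and ?S = "Some ` (\<Lambda> - V)"
  let ?G = "gexp (quadratic_action (mass_minus_adjacency ?E) ?S)"
  have V: "V \<subseteq> \<Lambda>" "finite V"
    using assms(2,4) by (auto simp: lattice_interior_def intro: finite_subset)
  have indep: "\<not> u \<sim> v" if "u \<in> V" "v \<in> V" for u v
    using assms(5) that by (auto simp: good_set_def)
  have denominator: "pinned_unnormalized \<Lambda> 1 = real (card (recurrent \<Lambda>))"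
    using assms(2)
    by (simp add: pinned_unnormalized_free_of_ghost free_of_one card_burnable_eq_partition_function
        nbr_count_le partition_function_def)
  have "pinned_unnormalized \<Lambda> ?XY = real (card (burnable (\<Lambda> - V) ?E))"
  proof -
    have "free_of None ?XY"
      using V(2) by (intro free_of_gprod free_of_mult free_of_fermion_X free_of_fermion_Y
          bosonic_mult bosonic_fermion_X bosonic_fermion_Y) auto
    then have "pinned_unnormalized \<Lambda> ?XY = gcoeff (berezin (Some ` \<Lambda>) (?G * gprod fermion_X V)) {}"
      by (simp add: pinned_unnormalized_free_of_ghost assms(2) action_split_bonds[OF assms(2,4) indep]
          gexp_bonds_XY V(2) gcoeff_action_empty)
    also have "berezin (Some ` \<Lambda>) (?G * gprod fermion_X V) = berezin ?S ?G"
    proof -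
      have "berezin (Some ` ((\<Lambda> - V) \<union> V)) (?G * gprod fermion_X V) = berezin ?S ?G"
        using V(2) assms(2) indep
        by (intro berezin_fermion_X free_of_gexp_action bosonic_gexp bosonic_action) auto
      then show ?thesis using V(1) by (simp only: Un_Diff_cancel2 Un_absorb2)
    qed
    also have "gcoeff \<dots> {} = real (card (burnable (\<Lambda> - V) ?E))"
      unfolding partition_function_def[symmetric]
    proof (rule card_burnable_eq_partition_function[symmetric])
      have "(\<Lambda> - V) \<inter> V = {}" by auto
      from nbr_count_Un[OF this] have "nbr_count (\<Lambda> - V) u + nbr_count V u \<le> 2 * CARD('d)" for u
        using nbr_count_le[of "(\<Lambda> - V) \<union> V" u] by simp
      then show "nbr_count (\<Lambda> - V) u \<le> ?E u" for u by (simp add: le_diff_conv2 nbr_count_le)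
    qed (use assms(2) in auto)
    finally show ?thesis .
  qed
  also have "card (burnable (\<Lambda> - V) ?E) = card {\<rho> \<in> recurrent \<Lambda>. \<forall>v\<in>V. \<rho> v = 1}"
    by (rule card_burnable_height_one[OF assms(2) V(1) indep, symmetric]) (auto simp: Suc_le_eq)
  finally show ?thesis
    unfolding pinned_state_def denominator sandpile_expectation_height_one[OF assms(2) V(1)] by simp
qed

end
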